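(* Let $G$ be a countably infinite amenable group, let $W$ be a sofic $G$-shift, and let $V\subset W$ be any subsystem (i.e. subshift contained in $W$, possibly empty) such that $h(V) < h(W)$. Then the set $$\{h(U) : V\subset U\subset W \text{ and } U \text{ is sofic}\}$$ is dense in the interval $[h(V), h(W)]$.
   Context: Let $G$ be a countably infinite group. A Følner sequence for $G$ is a sequence $(F_n)_n$ of finite subsets of $G$ such that each $g\in G$ lies in $F_n$ for all sufficiently large $n$, and $\lim_{n\to\infty} |KF_n \triangle F_n|/|F_n| = 0$ for every finite $K\subset G$, where $KF=\{kf: k\in K, f\in F\}$. $G$ is amenable if such a sequence exists. For a finite set $\mathcal A$ (alphabet, discrete topology), $\mathcal A^G$ carries the product topology and the $G$-action $(\sigma^g x)_h = x_{hg}$ for $g,h\in G$. A subshift is a closed subset $X\subset \mathcal A^G$ with $\sigma^g x\in X$ for all $x\in X$, $g\in G$ (the empty set is allowed). A subsystem of a subshift is a subshift contained in it. A pattern is a function $p:F\to\mathcal A$ with $F\subset G$ finite; it occurs in $x$ if $(\sigma^g x)|_F = p$ for some $g\in G$. $X\subset\mathcal A^G$ is a shift of finite type (SFT) if there is a finite collection $\mathcal F$ of patterns such that $X$ is the set of all $x\in\mathcal A^G$ in which no $p\in\mathcal F$ occurs. A factor map between subshifts (over possibly different finite alphabets) is a continuous surjection commuting with all $\sigma^g$. A subshift $W$ is sofic if there is an SFT $X$ and a factor map $X\to W$. For finite $F\subset G$, let $\mathcal P(F,X)=\{(\sigma^g x)|_F : x\in X, g\in G\}$. The entropy of a nonempty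 subshift is $h(X)=\lim_{n\to\infty}\frac{1}{|F_n|}\log|\mathcal P(F_n,X)|$ (the limit exists and does not depend on the Følner sequence); by convention $h(\varnothing)=0$. *)

theory Defs
  imports "HOL-Analysis.Analysis"
begin

text \<open>
  The ambient group is a type of class \<open>group_add\<close>, i.e. a not necessarily commutative group
  written additively: \<open>k + f\<close> stands for the product $kf$.
  Alphabets are finite sets \<open>A\<close> of symbols; a configuration over \<open>A\<close> is a function into \<open>A\<close>.
\<close>

text \<open>
  The sets \<open>K\<close> have to be nonempty: for $K = \emptyset$ the quotient is eventually 1, so admitting
  the empty set would leave no Folner sequences at all.  Since every group element eventually
  lies in \<open>F n\<close>, the denominators are eventually nonzero.
\<close>

definition folner_sequence :: "(nat \<Rightarrow> 'g::group_add set) \<Rightarrow> bool" where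
  "folner_sequence F \<longleftrightarrow>
     (\<forall>n. finite (F n)) \<and>
     (\<forall>g. \<forall>\<^sub>F n in sequentially. g \<in> F n) \<and>
     (\<forall>K. finite K \<and> K \<noteq> {} \<longrightarrow>
        (\<lambda>n. real (card (sym_diff {k + f |k f. k \<in> K \<and> f \<in> F n} (F n))) / real (card (F n)))
          \<longlonglongrightarrow> 0)"

definition amenable :: "'g::group_add itself \<Rightarrow> bool" where
  "amenable _ \<longleftrightarrow> (\<exists>F :: nat \<Rightarrow> 'g set. folner_sequence F)"

definition full_shift :: "'a set \<Rightarrow> ('g \<Rightarrow> 'a) topology" where
  "full_shift A = product_topology (\<lambda>_. discrete_topology A) UNIV"

definition shift :: "'g::group_add \<Rightarrow> ('g \<Rightarrow> 'a) \<Rightarrow> ('g \<Rightarrow> 'a)" where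
  "shift g x = (\<lambda>h. x (h + g))"

definition subshift :: "'a set \<Rightarrow> ('g::group_add \<Rightarrow> 'a) set \<Rightarrow> bool" where
  "subshift A X \<longleftrightarrow>
     finite A \<and> closedin (full_shift A) X \<and> (\<forall>x\<in>X. \<forall>g. shift g x \<in> X)"

text \<open>
  A pattern $p : F \to A$ is a partial map with domain \<open>F\<close>.
\<close>

definition pattern :: "'a set \<Rightarrow> ('g \<rightharpoonup> 'a) \<Rightarrow> bool" where
  "pattern A p \<longleftrightarrow> finite (dom p) \<and> ran p \<subseteq> A"

definition restrict_config :: "('g \<Rightarrow> 'a) \<Rightarrow> 'g set \<Rightarrow> ('g \<rightharpoonup> 'a)" where
  "restrict_config x F = (\<lambda>h. Some (x h)) |` F"

definition occurs_in :: "('g::group_add \<rightharpoonup> 'a) \<Rightarrow> ('g \<Rightarrow> 'a) \<Rightarrow> bool" where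
  "occurs_in p x \<longleftrightarrow> (\<exists>g. restrict_config (shift g x) (dom p) = p)"

definition sft :: "'a set \<Rightarrow> ('g::group_add \<Rightarrow> 'a) set \<Rightarrow> bool" where
  "sft A X \<longleftrightarrow> finite A \<and>
     (\<exists>P. finite P \<and> (\<forall>p\<in>P. pattern A p) \<and>
          X = {x \<in> topspace (full_shift A). \<forall>p\<in>P. \<not> occurs_in p x})"

definition factor_map ::
  "'b set \<Rightarrow> ('g::group_add \<Rightarrow> 'b) set \<Rightarrow> 'a set \<Rightarrow> ('g \<Rightarrow> 'a) set \<Rightarrow>
   (('g \<Rightarrow> 'b) \<Rightarrow> ('g \<Rightarrow> 'a)) \<Rightarrow> bool" where
  "factor_map B X A W \<phi> \<longleftrightarrow>
     continuous_map (subtopology (full_shift B) X) (subtopology (full_shift A) W) \<phi> \<and>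
     \<phi> ` X = W \<and>
     (\<forall>x\<in>X. \<forall>g. \<phi> (shift g x) = shift g (\<phi> x))"

text \<open>
  Quantification over all finite alphabets of the covering SFT is expressed by finite sets of
  natural numbers; every finite alphabet is in bijection with one of these.
\<close>

definition sofic :: "'a set \<Rightarrow> ('g::group_add \<Rightarrow> 'a) set \<Rightarrow> bool" where
  "sofic A W \<longleftrightarrow> subshift A W \<and>
     (\<exists>(B :: nat set) X \<phi>. sft B X \<and> factor_map B X A W \<phi>)"

definition patterns_of :: "'g::group_add set \<Rightarrow> ('g \<Rightarrow> 'a) set \<Rightarrow> ('g \<rightharpoonup> 'a) set" where
  "patterns_of F X = {restrict_config (shift g x) F |x g. x \<in> X}"

text \<open>
  The entropy is the common limit along all Folner sequences; it exists for a nonempty subshift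
  over an amenable group (Ornstein--Weiss).
\<close>

definition shift_entropy :: "('g::group_add \<Rightarrow> 'a) set \<Rightarrow> real" where
  "shift_entropy X =
     (if X = {} then 0
      else THE h. \<forall>F. folner_sequence F \<longrightarrow>
             (\<lambda>n. ln (real (card (patterns_of (F n) X))) / real (card (F n))) \<longlonglongrightarrow> h)"

end

theory Submission imports Defs begin

text \<open>
  \<^bold>\<open>Entropy.\<close>  Shearer's inequality bounds the number of blocks of a shift \<open>X\<close> on any finite set by
  its numbers of blocks on translates of one finite set \<open>K\<close>.  Hence $h(X)$ is the infimum over all
  nonempty finite \<open>K\<close> of the block rate $\log |P(K,X)| / |K|$, and every Folner sequence realises it
  (\<open>shift_entropy_le_block_rate\<close>, \<open>block_rate_tendsto_shift_entropy\<close>).  In particular entropy is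
  monotone, which places all the entropies in the interval, and an upper bound for the block rate on
  a single set is an upper bound for the entropy.

  \<^bold>\<open>Density.\<close>  Suppose that no sofic shift between \<open>V\<close> and \<open>W\<close> has entropy within $r$ of some
  $h \in [h(V), h(W)]$.  Let $b \geq h + r$ be the infimum of the entropies of those intermediate sofic
  shifts whose entropy is at least $h$, and let \<open>U0 = \<phi> ` X\<close>, with \<open>X\<close> a shift of finite type, be one
  whose entropy is almost $b$.  The contradiction comes from a chain of intermediate sofic shifts
  that starts at \<open>U0\<close> and whose entropies decrease in steps smaller than $r$: no step can cross the
  gap around $h$, so all of them are at least $b$, and yet the last one turns out to be below $b$.

  The chain is obtained by \<open>thinning\<close>.  Fix a large and very invariant finite set \<open>F\<close>.  A \<open>tile layer\<close>
  places labelled translates of \<open>F\<close> in the group; where they overlap, the smaller label wins, so that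
  every one of them keeps a \<open>tile\<close>, and the rules say that a tile has at least half the size of \<open>F\<close>
  and that at least half of every translate of \<open>F\<close> is covered.  For a set \<open>S\<close> of patterns,
  \<open>thinned F L S\<close> is the image under \<open>\<phi>\<close> of those points of \<open>X\<close> that show only patterns of \<open>S\<close> on
  the tiles of some layer.  The layers obey a finite rule, so thinned shifts are sofic (\<open>sofic_thinned\<close>); they contain \<open>V\<close> as soon
  as \<open>S\<close> contains all patterns of preimages of points of \<open>V\<close>.

  Two estimates finish the proof.  If a pattern is removed from \<open>S\<close> while another one with the same
  outer ring stays, then the removed pattern can be exchanged for the other one wherever it occurs on
  a tile, without leaving \<open>X\<close>; the original image is recovered from the new one and the set of
  tiles that were changed, and this set costs little because tiles are large (\<open>entropy_drop_le\<close>).  Removing patterns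
  in this way as long as the entropy stays at least $h$ ends with a set \<open>S\<close> in which a pattern is
  either determined by its ring or comes from \<open>V\<close>.  Then a tile carries hardly more patterns than
  \<open>V\<close> allows, and since the tiles fill a fixed proportion of the group, the entropy is below $b$ by a
  definite amount (\<open>entropy_thinned_le\<close>).  It matters here that the covered proportion does not depend
  on \<open>F\<close>, because \<open>F\<close> is chosen after \<open>U0\<close>, that is after the distance from $h(U0)$ to $b$ is fixed.
\<close>

section \<open>Counting blocks and Shearer's inequality\<close>

text \<open>
  Arbitrary sets of configurations are admitted because Shearer's inequality is proved by slicing,
  and because the counting below splits a shift according to its tilings.
\<close>

definition block_count :: "'g set \<Rightarrow> ('g \<Rightarrow> 'a) set \<Rightarrow> nat" where
  "block_count E Z = card ((\<lambda>x. restrict_config x E) ` Z)"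

lemma restrict_config_eq_iff:
  "restrict_config x E = restrict_config y E \<longleftrightarrow> (\<forall>e\<in>E. x e = y e)"
  by (auto simp: restrict_config_def restrict_map_def fun_eq_iff)

lemma dom_restrict_config [simp]: "dom (restrict_config x E) = E"
  by (auto simp: restrict_config_def restrict_map_def dom_def)

lemma restrict_config_apply: "e \<in> E \<Longrightarrow> restrict_config x E e = Some (x e)"
  by (simp add: restrict_config_def)

lemma ran_restrict_config: "ran (restrict_config x E) = x ` E"
  by (auto simp: ran_def restrict_config_def restrict_map_def)

lemma finite_partial_maps:
  assumes "finite D" "finite R"
  shows "finite {p. dom p \<subseteq> D \<and> ran p \<subseteq> R}"
proof -
  have "{p. dom p \<subseteq> D \<and> ran p \<subseteq> R} = (\<Union>D' \<in> Pow D. {p. dom p = D' \<and> ran p \<subseteq> R})"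
    by auto
  moreover have "finite {p. dom p = D' \<and> ran p \<subseteq> R}" if "D' \<in> Pow D" for D'
    using that assms finite_subset by (intro finite_set_of_finite_maps) auto
  ultimately show ?thesis
    using assms(1) by simp
qed

lemma finite_blocks:
  assumes "finite E" "finite A" "\<And>x. x \<in> Z \<Longrightarrow> range x \<subseteq> A"
  shows "finite ((\<lambda>x. restrict_config x E) ` Z)"
proof (rule finite_subset)
  show "(\<lambda>x. restrict_config x E) ` Z \<subseteq> {p. dom p \<subseteq> E \<and> ran p \<subseteq> A}"
    using assms(3) by (force simp: ran_restrict_config)
qed (simp add: finite_partial_maps assms)

lemma card_image_le_of_determined:
  assumes "finite (g ` Z)" "\<And>x y. \<lbrakk>x \<in> Z; y \<in> Z; g x = g y\<rbrakk> \<Longrightarrow> f x = f y"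
  shows "card (f ` Z) \<le> card (g ` Z)"
proof -
  define k where "k v = f (SOME x. x \<in> Z \<and> g x = v)" for v
  have "k (g x) = f x" if "x \<in> Z" for x
  proof -
    have "(SOME x'. x' \<in> Z \<and> g x' = g x) \<in> Z \<and> g (SOME x'. x' \<in> Z \<and> g x' = g x) = g x"
      by (rule someI[of _ x]) (simp add: that)
    then show ?thesis
      unfolding k_def using assms(2) that by blast
  qed
  then have "f ` Z = k ` g ` Z"
    by (force simp: image_iff)
  then show ?thesis
    using card_image_le[OF assms(1)] by metis
qed

locale finite_alphabet =
  fixes Z :: "('g \<Rightarrow> 'a) set" and A :: "'a set"
  assumes finite_alphabet: "finite A"
    and range_subset: "\<And>x. x \<in> Z \<Longrightarrow> range x \<subseteq> A"
begin

lemma finite_block_image: "finite E \<Longrightarrow> finite ((\<lambda>x. restrict_config x E) ` Z)"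
  by (rule finite_blocks[OF _ finite_alphabet range_subset])

lemma block_count_mono_set: "finite E \<Longrightarrow> Z' \<subseteq> Z \<Longrightarrow> block_count E Z' \<le> block_count E Z"
  unfolding block_count_def by (intro card_mono finite_block_image image_mono)

lemma block_count_pos: "finite E \<Longrightarrow> Z \<noteq> {} \<Longrightarrow> block_count E Z > 0"
  unfolding block_count_def by (simp add: card_gt_0_iff finite_block_image)

lemma block_count_Un:
  assumes "finite E" "finite E'"
  shows "block_count (E \<union> E') Z \<le> block_count E Z * block_count E' Z"
proof -
  let ?g = "\<lambda>x. (restrict_config x E, restrict_config x E')"
  have sub: "?g ` Z \<subseteq> ((\<lambda>x. restrict_config x E) ` Z) \<times> ((\<lambda>x. restrict_config x E') ` Z)"
    by auto
  have fin: "finite (((\<lambda>x. restrict_config x E) ` Z) \<times> ((\<lambda>x. restrict_config x E') ` Z))"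
    using assms finite_block_image by blast
  have "block_count (E \<union> E') Z \<le> card (?g ` Z)"
    unfolding block_count_def using finite_subset[OF sub fin]
    by (intro card_image_le_of_determined) (auto simp: restrict_config_eq_iff)
  also have "\<dots> \<le> block_count E Z * block_count E' Z"
    unfolding block_count_def card_cartesian_product[symmetric] using card_mono[OF fin sub] .
  finally show ?thesis .
qed

lemma block_count_le_alphabet_power:
  assumes "finite E"
  shows "block_count E Z \<le> card A ^ card E"
proof -
  let ?g = "\<lambda>x. restrict x E"
  have sub: "?g ` Z \<subseteq> E \<rightarrow>\<^sub>E A"
  proof
    fix w assume "w \<in> ?g ` Z"
    then obtain x where "x \<in> Z" "w = restrict x E" by blast
    then show "w \<in> E \<rightarrow>\<^sub>E A"
      using range_subset[of x] by (simp add: PiE_iff image_subset_iff)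
  qed
  have fin: "finite (E \<rightarrow>\<^sub>E A)"
    using assms finite_alphabet by (simp add: finite_PiE)
  have "x e = y e" if "?g x = ?g y" "e \<in> E" for x y :: "'g \<Rightarrow> 'a" and e
    using fun_cong[OF that(1), of e] that(2) by simp
  then have "block_count E Z \<le> card (?g ` Z)"
    unfolding block_count_def using finite_subset[OF sub fin]
    by (intro card_image_le_of_determined) (auto simp only: restrict_config_eq_iff)
  also have "\<dots> \<le> card A ^ card E"
    using card_mono[OF fin sub] assms by (simp add: card_PiE)
  finally show ?thesis .
qed

end

lemma finite_alphabet_subset: "finite_alphabet Z A \<Longrightarrow> Z' \<subseteq> Z \<Longrightarrow> finite_alphabet Z' A"
  unfolding finite_alphabet_def by auto

lemma block_count_UN_le:
  assumes "finite J" "finite_alphabet Z A" "\<And>j. j \<in> J \<Longrightarrow> finite (E j)"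
  shows "block_count (\<Union>j\<in>J. E j) Z \<le> (\<Prod>j\<in>J. block_count (E j) Z)"
  using assms(1,3)
proof (induction J rule: finite_induct)
  case empty
  have "finite_alphabet Z A" by fact
  from finite_alphabet.block_count_le_alphabet_power[OF this, of "{}"] show ?case by simp
next
  case (insert j J)
  have "block_count (\<Union>i\<in>insert j J. E i) Z = block_count (E j \<union> (\<Union>i\<in>J. E i)) Z"
    by simp
  also have "\<dots> \<le> block_count (E j) Z * block_count (\<Union>i\<in>J. E i) Z"
    using insert by (intro finite_alphabet.block_count_Un[OF assms(2)]) auto
  also have "\<dots> \<le> block_count (E j) Z * (\<Prod>i\<in>J. block_count (E i) Z)"
    using insert by (intro mult_left_mono) auto
  finally show ?case
    using insert by simp
qed

lemma AM_GM_power: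
  fixes a :: "'j \<Rightarrow> real"
  assumes "finite J" "J \<noteq> {}" "\<And>j. j \<in> J \<Longrightarrow> a j \<ge> 0"
  shows "(\<Prod>j\<in>J. a j) \<le> ((\<Sum>j\<in>J. a j) / card J) ^ card J"
proof -
  define m where "m = (\<Sum>j\<in>J. a j) / card J"
  have card: "card J > 0" using assms by (simp add: card_gt_0_iff)
  have m0: "m \<ge> 0" unfolding m_def using assms by (simp add: sum_nonneg)
  show ?thesis
  proof (cases "m = 0")
    case True
    then have "(\<Sum>j\<in>J. a j) = 0" using card by (auto simp: m_def)
    then have "\<forall>j\<in>J. a j = 0" using assms by (simp add: sum_nonneg_eq_0_iff)
    then have "(\<Prod>j\<in>J. a j) = 0" using assms by (metis prod_zero ex_in_conv)
    then show ?thesis using m0 by (simp add: m_def)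
  next
    case False
    then have m: "m > 0" using m0 by simp
    have "(\<Prod>j\<in>J. a j / m) \<le> (\<Prod>j\<in>J. exp (a j / m - 1))"
    proof (rule prod_mono)
      fix j assume "j \<in> J"
      then show "0 \<le> a j / m \<and> a j / m \<le> exp (a j / m - 1)"
        using assms(3) m exp_ge_add_one_self[of "a j / m - 1"] by simp
    qed
    also have "\<dots> = exp ((\<Sum>j\<in>J. a j) / m - card J)"
      using assms(1) by (simp add: exp_sum[symmetric] sum_subtractf sum_divide_distrib)
    also have "(\<Sum>j\<in>J. a j) / m - card J = 0"
      using m card by (simp add: m_def field_simps)
    finally have "(\<Prod>j\<in>J. a j) / m ^ card J \<le> 1"
      by (simp add: prod_dividef)
    then show ?thesis
      using m by (simp add: m_def[symmetric] field_simps)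
  qed
qed

text \<open>
  This is the generalised Hoelder inequality with \<open>card J\<close> equal exponents, raised to the power
  \<open>card J\<close> so that no roots of natural numbers have to be handled.  After normalising every
  \<open>f j\<close> to have sum 1, it is the sum over \<open>V\<close> of inequalities between geometric and arithmetic
  means.
\<close>

lemma Hoelder_power:
  fixes g :: "'a \<Rightarrow> real" and f :: "'j \<Rightarrow> 'a \<Rightarrow> real"
  assumes "finite V" "finite J" "J \<noteq> {}" "P \<ge> 0"
    and g0: "\<And>a. a \<in> V \<Longrightarrow> g a \<ge> 0"
    and f0: "\<And>j a. j \<in> J \<Longrightarrow> a \<in> V \<Longrightarrow> f j a \<ge> 0"
    and le: "\<And>a. a \<in> V \<Longrightarrow> g a ^ card J \<le> P * (\<Prod>j\<in>J. f j a)"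
  shows "(\<Sum>a\<in>V. g a) ^ card J \<le> P * (\<Prod>j\<in>J. \<Sum>a\<in>V. f j a)"
proof -
  define k where "k = card J"
  define s where "s j = (\<Sum>a\<in>V. f j a)" for j
  have k: "k > 0" using assms by (simp add: k_def card_gt_0_iff)
  have s0: "s j \<ge> 0" if "j \<in> J" for j
    unfolding s_def using f0 that by (intro sum_nonneg) auto
  define Q where "Q = P * (\<Prod>j\<in>J. s j)"
  have Q0: "Q \<ge> 0"
    unfolding Q_def using assms s0 by (intro mult_nonneg_nonneg prod_nonneg) auto
  show ?thesis
  proof (cases "\<exists>j\<in>J. s j = 0")
    case True
    then obtain j where j: "j \<in> J" "s j = 0" by auto
    then have "f j a = 0" if "a \<in> V" for a
      using that f0 assms(1) unfolding s_def by (simp add: sum_nonneg_eq_0_iff)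
    then have "(\<Prod>j\<in>J. f j a) = 0" if "a \<in> V" for a
      using that j assms(2) by (auto intro!: prod_zero)
    then have "g a ^ k \<le> 0" if "a \<in> V" for a
      using le[OF that] that by (simp add: k_def)
    then have "g a = 0" if "a \<in> V" for a
      using g0[OF that] that k by (metis less_le not_le zero_less_power)
    then have "(\<Sum>a\<in>V. g a) ^ k = 0" using k by simp
    then show ?thesis using Q0 unfolding Q_def k_def s_def by linarith
  next
    case False
    then have spos: "s j > 0" if "j \<in> J" for j
      using s0 that by (metis less_le)
    have bound: "g a \<le> root k Q * ((\<Sum>j\<in>J. f j a / s j) / k)" if a: "a \<in> V" for a
    proof -
      have "g a = root k (g a ^ k)"
        using k g0[OF a] by (simp add: real_root_power_cancel)
      also have "\<dots> \<le> root k (P * (\<Prod>j\<in>J. f j a))"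
        using le[OF a] k by (simp add: k_def)
      also have "P * (\<Prod>j\<in>J. f j a) = Q * (\<Prod>j\<in>J. f j a / s j)"
        using False assms(2) by (simp add: Q_def prod_dividef)
      also have "root k \<dots> = root k Q * root k (\<Prod>j\<in>J. f j a / s j)"
        by (simp add: real_root_mult)
      also have "\<dots> \<le> root k Q * ((\<Sum>j\<in>J. f j a / s j) / k)"
      proof (intro mult_left_mono)
        have nn: "0 \<le> f j a / s j" if "j \<in> J" for j
          using f0 s0 a that by simp
        have "root k (\<Prod>j\<in>J. f j a / s j) \<le> root k (((\<Sum>j\<in>J. f j a / s j) / k) ^ k)"
          unfolding k_def using AM_GM_power[OF assms(2,3) nn] k by (simp add: k_def)
        also have "\<dots> = (\<Sum>j\<in>J. f j a / s j) / k"
          using k nn by (intro real_root_power_cancel divide_nonneg_nonneg[OF sum_nonneg]) auto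
        finally show "root k (\<Prod>j\<in>J. f j a / s j) \<le> (\<Sum>j\<in>J. f j a / s j) / k" .
      qed (use k Q0 in simp)
      finally show ?thesis .
    qed
    have "(\<Sum>a\<in>V. g a) \<le> (\<Sum>a\<in>V. root k Q * ((\<Sum>j\<in>J. f j a / s j) / k))"
      using bound by (rule sum_mono)
    also have "\<dots> = root k Q * ((\<Sum>a\<in>V. \<Sum>j\<in>J. f j a / s j) / k)"
      by (simp add: sum_distrib_left sum_divide_distrib)
    also have "(\<Sum>a\<in>V. \<Sum>j\<in>J. f j a / s j) = (\<Sum>j\<in>J. s j / s j)"
      unfolding s_def by (subst sum.swap) (simp only: sum_divide_distrib[symmetric])
    also have "\<dots> = (\<Sum>j\<in>J. 1)"
      using False by (intro sum.cong) auto
    also have "\<dots> = k"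
      by (simp add: k_def)
    finally have "(\<Sum>a\<in>V. g a) \<le> root k Q"
      using k by simp
    then have "(\<Sum>a\<in>V. g a) ^ k \<le> root k Q ^ k"
      using g0 by (intro power_mono sum_nonneg) auto
    also have "\<dots> = Q"
      using k Q0 by simp
    finally show ?thesis by (simp add: Q_def k_def s_def)
  qed
qed

lemma block_count_insert:
  assumes "finite_alphabet Z A" "finite E" "e \<notin> E"
  shows "block_count (insert e E) Z = (\<Sum>a\<in>A. block_count E {x\<in>Z. x e = a})"
proof -
  interpret finite_alphabet Z A by fact
  let ?r = "\<lambda>x. restrict_config x (insert e E)"
  have "?r ` Z = (\<Union>a\<in>A. ?r ` {x\<in>Z. x e = a})"
    using range_subset by fast
  then have "block_count (insert e E) Z = card (\<Union>a\<in>A. ?r ` {x\<in>Z. x e = a})"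
    by (simp add: block_count_def)
  also have "\<dots> = (\<Sum>a\<in>A. card (?r ` {x\<in>Z. x e = a}))"
  proof (rule card_UN_disjoint)
    show "finite A" by (rule finite_alphabet)
    show "\<forall>a\<in>A. finite (?r ` {x\<in>Z. x e = a})"
      using finite_block_image[of "insert e E"] assms(2) by (auto intro: finite_subset[rotated])
    show "\<forall>i\<in>A. \<forall>j\<in>A. i \<noteq> j \<longrightarrow> ?r ` {x\<in>Z. x e = i} \<inter> ?r ` {x\<in>Z. x e = j} = {}"
      by (auto simp: restrict_config_eq_iff)
  qed
  also have "\<dots> = (\<Sum>a\<in>A. block_count E {x\<in>Z. x e = a})"
  proof (rule sum.cong[OF refl])
    fix a
    have f1: "finite (?r ` {x\<in>Z. x e = a})"
      using finite_block_image[of "insert e E"] assms(2) by (auto intro: finite_subset[rotated])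
    have f2: "finite ((\<lambda>x. restrict_config x E) ` {x\<in>Z. x e = a})"
      using finite_block_image[of E] assms(2) by (auto intro: finite_subset[rotated])
    show "card (?r ` {x\<in>Z. x e = a}) = block_count E {x\<in>Z. x e = a}"
      unfolding block_count_def
      by (intro antisym card_image_le_of_determined f1 f2) (auto simp: restrict_config_eq_iff)
  qed
  finally show ?thesis .
qed

lemma block_count_insert_outside:
  "e \<notin> S \<Longrightarrow> block_count (S \<inter> insert e E) Z = block_count (S \<inter> E) Z"
  by (simp add: Int_insert_right)

text \<open>
  Slice \<open>Z\<close> by the symbol at a new point \<open>e\<close>.  Counts on sets that contain \<open>e\<close> are sums over the
  slices, counts on the other sets only decrease in a slice, and exactly \<open>k\<close> of the sets
  contain \<open>e\<close>, so Hoelder's inequality recombines the induction hypotheses for the slices.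
\<close>

lemma Shearer_counting:
  fixes S :: "'j \<Rightarrow> 'g set"
  assumes "finite E" "finite J" "k > 0" "finite_alphabet Z A"
    and "\<And>e. e \<in> E \<Longrightarrow> card {j\<in>J. e \<in> S j} = k"
  shows "real (block_count E Z) ^ k \<le> (\<Prod>j\<in>J. real (block_count (S j \<inter> E) Z))"
  using assms(1,4,5)
proof (induction E arbitrary: Z rule: finite_induct)
  case (empty Z)
  interpret finite_alphabet Z A by fact
  show ?case
  proof (cases "Z = {}")
    case True
    then have "real (block_count {} Z) ^ k = 0"
      using \<open>k > 0\<close> by (simp add: block_count_def)
    then show ?thesis by (simp only:) (intro prod_nonneg ballI of_nat_0_le_iff)
  next
    case False
    then have "restrict_config x {} = Map.empty" for x :: "'g \<Rightarrow> 'a"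
      by (simp add: restrict_config_def)
    then have "block_count {} Z = 1"
      using False by (simp add: block_count_def image_constant_conv)
    then show ?thesis by simp
  qed
next
  case (insert e E Z)
  interpret finite_alphabet Z A by fact
  let ?Z = "\<lambda>a. {x\<in>Z. x e = a}"
  define J1 where "J1 = {j\<in>J. e \<in> S j}"
  define J0 where "J0 = {j\<in>J. e \<notin> S j}"
  have J: "J = J1 \<union> J0" "J1 \<inter> J0 = {}" and fJ: "finite J1" "finite J0"
    using assms(2) by (auto simp: J1_def J0_def)
  have cJ1: "card J1 = k" using insert.prems(2)[of e] by (simp add: J1_def)
  define P where "P = (\<Prod>j\<in>J0. real (block_count (S j \<inter> E) Z))"
  have fa: "finite_alphabet (?Z a) A" for a
    by (rule finite_alphabet_subset[OF insert.prems(1)]) auto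
  have IH: "real (block_count E (?Z a)) ^ card J1 \<le> P * (\<Prod>j\<in>J1. real (block_count (S j \<inter> E) (?Z a)))" for a
  proof -
    have "real (block_count E (?Z a)) ^ k \<le> (\<Prod>j\<in>J. real (block_count (S j \<inter> E) (?Z a)))"
      using insert.IH[OF fa] insert.prems(2) by simp
    also have "\<dots> = (\<Prod>j\<in>J0. real (block_count (S j \<inter> E) (?Z a))) * (\<Prod>j\<in>J1. real (block_count (S j \<inter> E) (?Z a)))"
      using J fJ by (simp add: prod.union_disjoint mult.commute)
    also have "\<dots> \<le> P * (\<Prod>j\<in>J1. real (block_count (S j \<inter> E) (?Z a)))"
      unfolding P_def using insert.hyps
      by (intro mult_right_mono prod_mono prod_nonneg conjI of_nat_mono block_count_mono_set) auto
    finally show ?thesis by (simp add: cJ1)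
  qed
  have "real (block_count (insert e E) Z) ^ k = (\<Sum>a\<in>A. real (block_count E (?Z a))) ^ card J1"
    using block_count_insert[OF insert.prems(1) insert.hyps(1,2)] by (simp add: cJ1)
  also have "\<dots> \<le> P * (\<Prod>j\<in>J1. \<Sum>a\<in>A. real (block_count (S j \<inter> E) (?Z a)))"
    using cJ1 assms(3) fJ IH finite_alphabet
    by (intro Hoelder_power) (auto simp: P_def prod_nonneg)
  also have "(\<Prod>j\<in>J1. \<Sum>a\<in>A. real (block_count (S j \<inter> E) (?Z a)))
      = (\<Prod>j\<in>J1. real (block_count (S j \<inter> insert e E) Z))"
  proof (rule prod.cong[OF refl])
    fix j assume "j \<in> J1"
    then have "S j \<inter> insert e E = insert e (S j \<inter> E)" by (auto simp: J1_def)
    then show "(\<Sum>a\<in>A. real (block_count (S j \<inter> E) (?Z a))) = real (block_count (S j \<inter> insert e E) Z)"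
      using block_count_insert[OF insert.prems(1), of "S j \<inter> E" e] insert.hyps by simp
  qed
  also have "P = (\<Prod>j\<in>J0. real (block_count (S j \<inter> insert e E) Z))"
    unfolding P_def by (rule prod.cong) (auto simp: J0_def block_count_insert_outside)
  also have "\<dots> * (\<Prod>j\<in>J1. real (block_count (S j \<inter> insert e E) Z)) = (\<Prod>j\<in>J. real (block_count (S j \<inter> insert e E) Z))"
    using J fJ by (simp add: prod.union_disjoint mult.commute)
  finally show ?case .
qed

section \<open>Entropy as an infimum of block rates\<close>

lemma shift_zero [simp]: "shift 0 x = x"
  by (simp add: shift_def)

lemma shift_shift: "shift g (shift h x) = shift (g + h) x"
  by (simp add: shift_def add.assoc)

definition shift_invariant :: "('g::group_add \<Rightarrow> 'a) set \<Rightarrow> bool" where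
  "shift_invariant X \<longleftrightarrow> (\<forall>x\<in>X. \<forall>g. shift g x \<in> X)"

lemma shift_invariantD: "shift_invariant X \<Longrightarrow> x \<in> X \<Longrightarrow> shift g x \<in> X"
  by (simp add: shift_invariant_def)

lemma card_patterns_of:
  assumes "shift_invariant X"
  shows "card (patterns_of F X) = block_count F X"
proof -
  have "patterns_of F X = (\<lambda>x. restrict_config x F) ` X"
  proof
    show "(\<lambda>x. restrict_config x F) ` X \<subseteq> patterns_of F X"
    proof
      fix p assume "p \<in> (\<lambda>x. restrict_config x F) ` X"
      then obtain x where "x \<in> X" "p = restrict_config (shift 0 x) F" by auto
      then show "p \<in> patterns_of F X" unfolding patterns_of_def by blast
    qed
  qed (use assms in \<open>auto simp: patterns_of_def shift_invariant_def\<close>)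
  then show ?thesis by (simp add: block_count_def)
qed

lemma block_count_translate:
  assumes "shift_invariant X" "finite_alphabet X A" "finite F"
  shows "block_count ((\<lambda>f. f + g) ` F) X = block_count F X"
proof -
  let ?r = "\<lambda>x. restrict_config x F" and ?s = "\<lambda>x. restrict_config x ((\<lambda>f. f + g) ` F)"
  interpret finite_alphabet X A by fact
  have surj: "shift g ` X = X"
  proof
    show "shift g ` X \<subseteq> X" using assms(1) by (auto simp: shift_invariant_def)
    show "X \<subseteq> shift g ` X"
    proof
      fix x assume "x \<in> X"
      then have "shift (- g) x \<in> X" "x = shift g (shift (- g) x)"
        using assms(1) by (auto simp: shift_invariant_def shift_shift)
      then show "x \<in> shift g ` X" by blast
    qed
  qed
  have iff: "?s x = ?s y \<longleftrightarrow> ?r (shift g x) = ?r (shift g y)" for x y :: "'a \<Rightarrow> 'b"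
    by (simp add: restrict_config_eq_iff shift_def)
  have "?r ` shift g ` X = ?r ` X"
    by (simp only: surj)
  then have img: "(\<lambda>x. ?r (shift g x)) ` X = ?r ` X"
    by (simp only: image_image)
  then have fin: "finite ((\<lambda>x. ?r (shift g x)) ` X)"
    using finite_block_image[OF assms(3)] by (simp only:)
  have "block_count ((\<lambda>f. f + g) ` F) X = card ((\<lambda>x. ?r (shift g x)) ` X)"
    unfolding block_count_def
    using fin finite_block_image[of "(\<lambda>f. f + g) ` F"] assms(3)
    by (intro antisym card_image_le_of_determined) (simp_all only: iff finite_imageI)
  also note img
  finally show ?thesis by (simp add: block_count_def)
qed

text \<open>
  Cover \<open>Q\<close> by the translates of \<open>K\<close> that meet it.  Each point of \<open>Q\<close> lies in exactly
  \<open>card K\<close> of them, and the translates that meet \<open>Q\<close> are indexed by \<open>uminus ` K + Q\<close>.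
\<close>

lemma block_count_le_exp:
  fixes \<alpha> :: real
  assumes "shift_invariant X" "finite_alphabet X A" "finite K" "K \<noteq> {}" "finite Q"
    and rate: "ln (real (block_count K X)) \<le> \<alpha> * card K"
  shows "real (block_count Q X) \<le> exp (\<alpha> * card (uminus ` K + Q))"
proof (cases "X = {}")
  case True
  then show ?thesis by (simp add: block_count_def)
next
  case False
  interpret finite_alphabet X A by fact
  define J where "J = uminus ` K + Q"
  define S where "S g = (\<lambda>k. k + g) ` K" for g
  have fJ: "finite J" unfolding J_def using assms by (intro finite_set_plus) auto
  have cover: "card {g \<in> J. q \<in> S g} = card K" if "q \<in> Q" for q
  proof -
    have "{g \<in> J. q \<in> S g} = (\<lambda>k. - k + q) ` K"
    proof (intro set_eqI iffI)
      fix g assume "g \<in> (\<lambda>k. - k + q) ` K"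
      then obtain k where k: "k \<in> K" "g = - k + q" by blast
      then have "q = k + g" by (simp add: add.assoc[symmetric])
      then have "q \<in> S g" unfolding S_def using k(1) by (rule image_eqI)
      then show "g \<in> {g \<in> J. q \<in> S g}" using k that by (auto simp: J_def)
    next
      fix g assume "g \<in> {g \<in> J. q \<in> S g}"
      then obtain k where "k \<in> K" "q = k + g" by (auto simp: S_def)
      moreover from this have "g = - k + q" by (simp add: add.assoc[symmetric])
      ultimately show "g \<in> (\<lambda>k. - k + q) ` K" by blast
    qed
    moreover have "inj_on (\<lambda>k. - k + q) K"
      by (auto simp: inj_on_def)
    ultimately show ?thesis by (simp add: card_image)
  qed
  have "real (block_count Q X) ^ card K \<le> (\<Prod>g\<in>J. real (block_count (S g \<inter> Q) X))"
    using assms cover fJ by (intro Shearer_counting) (auto simp: card_gt_0_iff)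
  also have "\<dots> \<le> (\<Prod>g\<in>J. exp (\<alpha> * card K))"
  proof (rule prod_mono, safe)
    fix g
    have "block_count (S g \<inter> Q) X \<le> block_count (S g) X"
      unfolding block_count_def using finite_block_image[of "S g"] assms(3)
      by (intro card_image_le_of_determined) (auto simp: restrict_config_eq_iff S_def)
    also have "\<dots> = block_count K X"
      unfolding S_def using assms by (intro block_count_translate)
    finally have "real (block_count (S g \<inter> Q) X) \<le> real (block_count K X)" by simp
    also have "\<dots> \<le> exp (\<alpha> * card K)"
      using rate block_count_pos[OF assms(3) False] by (metis exp_le_cancel_iff exp_ln of_nat_0_less_iff)
    finally show "real (block_count (S g \<inter> Q) X) \<le> exp (\<alpha> * card K)" .
  qed simp
  also have "\<dots> = exp (\<alpha> * card J) ^ card K"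
    by (simp add: exp_of_nat_mult[symmetric] mult_ac)
  finally show ?thesis
    using assms by (auto simp: J_def card_gt_0_iff intro: power_le_imp_le_base[where n = "card K - 1"])
qed

text \<open>
  Both sides of the boundary are bounded: the points that \<open>K\<close> moves into the complement from \<open>E\<close>,
  and the points of \<open>E\<close> that \<open>K\<close> moves out.
\<close>

definition almost_invariant :: "'g::group_add set \<Rightarrow> real \<Rightarrow> 'g set \<Rightarrow> bool" where
  "almost_invariant K \<delta> E \<longleftrightarrow> finite E \<and> E \<noteq> {} \<and>
     real (card (K + E - E)) \<le> \<delta> * card E \<and> real (card {e\<in>E. \<exists>k\<in>K. k + e \<notin> E}) \<le> \<delta> * card E"

lemma folner_sequence_finite: "folner_sequence F \<Longrightarrow> finite (F n)"
  by (simp add: folner_sequence_def)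

lemma folner_sequence_nonempty:
  "folner_sequence F \<Longrightarrow> \<forall>\<^sub>F n in sequentially. F n \<noteq> {}"
  unfolding folner_sequence_def by (auto elim!: allE[of _ 0] eventually_mono)

lemma almost_invariant_folner:
  fixes K :: "'g::group_add set"
  assumes "folner_sequence F" "finite K" "\<delta> > 0"
  shows "\<forall>\<^sub>F n in sequentially. almost_invariant K \<delta> (F n)"
proof (cases "K = {}")
  case True
  show ?thesis
    using folner_sequence_nonempty[OF assms(1)]
    by eventually_elim (use assms True in \<open>auto simp: almost_invariant_def folner_sequence_finite\<close>)
next
  case False
  define \<delta>' where "\<delta>' = \<delta> / card K"
  have cK: "card K \<ge> 1" using False assms(2) by (simp add: Suc_le_eq card_gt_0_iff)
  have "\<delta>' > 0" using cK assms by (simp add: \<delta>'_def)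
  have KE: "{k + f |k f. k \<in> K \<and> f \<in> F n} = K + F n" for n
    by (auto simp: set_plus_def)
  have "(\<lambda>n. real (card (sym_diff (K + F n) (F n))) / real (card (F n))) \<longlonglongrightarrow> 0"
    using assms False unfolding folner_sequence_def KE[symmetric] by blast
  then have "\<forall>\<^sub>F n in sequentially. real (card (sym_diff (K + F n) (F n))) / real (card (F n)) < \<delta>'"
    using \<open>\<delta>' > 0\<close> order_tendstoD by blast
  with folner_sequence_nonempty[OF assms(1)] show ?thesis
  proof eventually_elim
    case (elim n)
    let ?E = "F n"
    have fE: "finite ?E" using assms by (simp add: folner_sequence_finite)
    have fKE: "finite (K + ?E)" using fE assms by (intro finite_set_plus)
    have cE: "card ?E > 0" using elim fE by (simp add: card_gt_0_iff)
    have "card (K + ?E - ?E) \<le> card (sym_diff (K + ?E) ?E)"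
      using fKE fE by (intro card_mono) auto
    then have le: "real (card (K + ?E - ?E)) \<le> \<delta>' * card ?E"
      using elim(2) cE by (simp add: field_simps)
    have "{e\<in>?E. \<exists>k\<in>K. k + e \<notin> ?E} = (\<Union>k\<in>K. {e\<in>?E. k + e \<notin> ?E})" by auto
    then have "card {e\<in>?E. \<exists>k\<in>K. k + e \<notin> ?E} \<le> (\<Sum>k\<in>K. card {e\<in>?E. k + e \<notin> ?E})"
      using card_UN_le[OF assms(2)] by simp
    also have "\<dots> \<le> (\<Sum>k\<in>K. card (K + ?E - ?E))"
    proof (rule sum_mono)
      fix k assume "k \<in> K"
      then show "card {e\<in>?E. k + e \<notin> ?E} \<le> card (K + ?E - ?E)"
        using fKE by (intro card_inj_on_le[where f = "\<lambda>e. k + e"]) (auto simp: inj_on_def)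
    qed
    also have "\<dots> = card K * card (K + ?E - ?E)" by simp
    finally have "real (card {e\<in>?E. \<exists>k\<in>K. k + e \<notin> ?E}) \<le> card K * real (card (K + ?E - ?E))"
      by (simp only: of_nat_mult[symmetric] of_nat_le_iff)
    also have "\<dots> \<le> card K * (\<delta>' * card ?E)"
      using le by (intro mult_left_mono) auto
    also have "\<dots> = \<delta> * card ?E" using cK by (simp add: \<delta>'_def)
    finally have 2: "real (card {e\<in>?E. \<exists>k\<in>K. k + e \<notin> ?E}) \<le> \<delta> * card ?E" .
    have "\<delta>' * card ?E \<le> \<delta> * card ?E"
      using cK assms(3) by (intro mult_right_mono) (auto simp: \<delta>'_def divide_le_eq_1 field_simps)
    then show ?case using le 2 fE elim by (simp add: almost_invariant_def)
  qed
qed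

lemma almost_invariant_card_plus:
  assumes "almost_invariant K \<delta> E" "finite K"
  shows "real (card (K + E)) \<le> (1 + \<delta>) * card E"
proof -
  have fin: "finite E" "finite (K + E)" using assms by (auto simp: almost_invariant_def finite_set_plus)
  have "card (K + E) \<le> card (E \<union> (K + E - E))"
    using fin by (intro card_mono) auto
  also have "\<dots> \<le> card E + card (K + E - E)" by (rule card_Un_le)
  finally have "real (card (K + E)) \<le> card E + card (K + E - E)" by linarith
  then show ?thesis using assms(1) by (simp add: almost_invariant_def distrib_right)
qed

lemma almost_invariant_mono:
  assumes "almost_invariant K \<delta> E" "K' \<subseteq> K" "\<delta> \<le> \<delta>'" "finite K"
  shows "almost_invariant K' \<delta>' E"
proof -
  have fin: "finite E" "finite (K + E)" using assms by (auto simp: almost_invariant_def finite_set_plus)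
  have "card (K' + E - E) \<le> card (K + E - E)"
    using fin assms(2) by (intro card_mono Diff_mono set_plus_mono2) auto
  moreover have "card {e\<in>E. \<exists>k\<in>K'. k + e \<notin> E} \<le> card {e\<in>E. \<exists>k\<in>K. k + e \<notin> E}"
    using fin assms(2) by (intro card_mono) auto
  moreover have "\<delta> * card E \<le> \<delta>' * card E"
    using assms(3) by (intro mult_right_mono) auto
  ultimately show ?thesis using assms(1) by (simp add: almost_invariant_def)
qed

lemma card_folner_unbounded:
  assumes "folner_sequence (F :: nat \<Rightarrow> 'g::group_add set)" "infinite (UNIV :: 'g set)"
  shows "\<forall>\<^sub>F n in sequentially. m \<le> card (F n)"
proof -
  obtain S :: "'g set" where S: "finite S" "card S = m"
    using infinite_arbitrarily_large[OF assms(2)] by blast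
  have "\<forall>\<^sub>F n in sequentially. \<forall>g\<in>S. g \<in> F n"
    using assms(1) S(1) by (intro eventually_ball_finite) (auto simp: folner_sequence_def)
  then show ?thesis
    by eventually_elim (use S assms(1) in \<open>auto intro!: card_mono simp: folner_sequence_finite\<close>)
qed

definition block_rate :: "'g set \<Rightarrow> ('g \<Rightarrow> 'a) set \<Rightarrow> real" where
  "block_rate K X = ln (real (block_count K X)) / card K"

lemma block_rate_nonneg:
  assumes "finite_alphabet X A" "finite K"
  shows "block_rate K X \<ge> 0"
proof (cases "X = {}")
  case False
  then show ?thesis
    using finite_alphabet.block_count_pos[OF assms] by (simp add: block_rate_def Suc_le_eq)
qed (simp add: block_rate_def block_count_def)

text \<open>
  The infimum is a lower bound of every rate.  Conversely, if the rate of \<open>K\<close> is close to the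
  infimum, then Shearer's inequality transfers the rate of \<open>K\<close> to every set that is almost
  invariant under \<open>uminus ` K\<close>.
\<close>

lemma block_rate_limit:
  fixes X :: "('g::group_add \<Rightarrow> 'a) set"
  assumes X: "shift_invariant X" "finite_alphabet X A" and F: "folner_sequence F"
  shows "(\<lambda>n. block_rate (F n) X) \<longlonglongrightarrow> (INF K\<in>{K. finite K \<and> K \<noteq> {}}. block_rate K X)"
proof -
  let ?\<K> = "{K :: 'g set. finite K \<and> K \<noteq> {}}"
  define h where "h = (INF K\<in>?\<K>. block_rate K X)"
  have bdd: "bdd_below ((\<lambda>K. block_rate K X) ` ?\<K>)"
    using block_rate_nonneg[OF X(2)] by (intro bdd_belowI[of _ 0]) auto
  have "{0} \<in> ?\<K>" by simp
  then have ne: "?\<K> \<noteq> {}" by blast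
  show ?thesis unfolding h_def[symmetric]
  proof (rule tendstoI)
    fix e :: real assume "e > 0"
    have "\<exists>K\<in>?\<K>. block_rate K X < h + e / 2"
      using cINF_less_iff[OF ne bdd, of "h + e / 2"] \<open>e > 0\<close> by (simp add: h_def)
    then obtain K where K: "finite K" "K \<noteq> {}" "block_rate K X < h + e / 2" by auto
    define \<alpha> where "\<alpha> = block_rate K X"
    have a0: "\<alpha> \<ge> 0" unfolding \<alpha>_def using X K by (intro block_rate_nonneg)
    define \<delta> where "\<delta> = e / (2 * (\<alpha> + 1))"
    have d0: "\<delta> > 0" using a0 \<open>e > 0\<close> by (simp add: \<delta>_def)
    have ad: "\<alpha> * \<delta> \<le> e / 2"
      using a0 \<open>e > 0\<close> unfolding \<delta>_def by (simp add: field_simps)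
    have "\<forall>\<^sub>F n in sequentially. almost_invariant (uminus ` K) \<delta> (F n)"
      using F K d0 by (intro almost_invariant_folner) auto
    then show "\<forall>\<^sub>F n in sequentially. dist (block_rate (F n) X) h < e"
    proof eventually_elim
      case (elim n)
      let ?E = "F n"
      have E: "finite ?E" "?E \<noteq> {}" using elim by (auto simp: almost_invariant_def)
      then have cE: "card ?E > 0" by (simp add: card_gt_0_iff)
      have lower: "h \<le> block_rate ?E X"
        unfolding h_def using E bdd by (intro cINF_lower) auto
      have "block_rate ?E X \<le> \<alpha> * (1 + \<delta>)"
      proof (cases "X = {}")
        case True
        then show ?thesis using a0 d0 by (simp add: block_rate_def block_count_def)
      next
        case False
        have "ln (real (block_count K X)) \<le> \<alpha> * card K"
          using K by (simp add: \<alpha>_def block_rate_def)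
        from block_count_le_exp[OF X K(1,2) E(1) this]
        have "real (block_count ?E X) \<le> exp (\<alpha> * card (uminus ` K + ?E))" .
        also have "\<dots> \<le> exp (\<alpha> * ((1 + \<delta>) * card ?E))"
          using almost_invariant_card_plus[OF elim] K a0 by (auto intro!: mult_left_mono)
        finally have "ln (real (block_count ?E X)) \<le> \<alpha> * ((1 + \<delta>) * card ?E)"
          using finite_alphabet.block_count_pos[OF X(2) E(1) False]
          by (metis ln_exp ln_le_cancel_iff exp_gt_zero of_nat_0_less_iff)
        then show ?thesis using cE by (simp add: block_rate_def field_simps)
      qed
      also have "\<dots> \<le> \<alpha> + e / 2" using ad by (simp add: algebra_simps)
      also have "\<dots> < h + e" using K(3) by (simp add: \<alpha>_def)
      finally show ?case using lower by (simp add: dist_real_def)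
    qed
  qed
qed

lemma shift_entropy_eq_INF:
  fixes X :: "('g::group_add \<Rightarrow> 'a) set"
  assumes "shift_invariant X" "finite_alphabet X A" "amenable TYPE('g)"
  shows "shift_entropy X = (INF K\<in>{K. finite K \<and> K \<noteq> {}}. block_rate K X)"
proof -
  obtain F0 :: "nat \<Rightarrow> 'g set" where F0: "folner_sequence F0"
    using assms(3) by (auto simp: amenable_def)
  have lim: "(\<lambda>n. block_rate (F n) X) \<longlonglongrightarrow> (INF K\<in>{K. finite K \<and> K \<noteq> {}}. block_rate K X)"
    if "folner_sequence F" for F
    using assms(1,2) that by (rule block_rate_limit)
  show ?thesis
  proof (cases "X = {}")
    case True
    then have "block_rate K X = 0" for K by (simp add: block_rate_def block_count_def)
    then have "(INF K\<in>{K. finite K \<and> K \<noteq> {}}. block_rate K X) = 0"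
      using lim[OF F0] by (simp add: LIMSEQ_const_iff)
    then show ?thesis using True by (simp add: shift_entropy_def)
  next
    case False
    have "(THE h. \<forall>F. folner_sequence F \<longrightarrow> (\<lambda>n. block_rate (F n) X) \<longlonglongrightarrow> h)
        = (INF K\<in>{K. finite K \<and> K \<noteq> {}}. block_rate K X)"
      using lim F0 LIMSEQ_unique by (intro the_equality) blast+
    then show ?thesis
      using False by (simp add: shift_entropy_def block_rate_def card_patterns_of[OF assms(1)])
  qed
qed

lemma shift_entropy_le_block_rate:
  fixes X :: "('g::group_add \<Rightarrow> 'a) set"
  assumes "shift_invariant X" "finite_alphabet X A" "amenable TYPE('g)" "finite K" "K \<noteq> {}"
  shows "shift_entropy X \<le> block_rate K X"
  unfolding shift_entropy_eq_INF[OF assms(1-3)] using assms block_rate_nonneg[OF assms(2)]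
  by (intro cINF_lower bdd_belowI[of _ 0]) auto

lemma block_rate_tendsto_shift_entropy:
  fixes X :: "('g::group_add \<Rightarrow> 'a) set"
  assumes "shift_invariant X" "finite_alphabet X A" "folner_sequence F"
  shows "(\<lambda>n. block_rate (F n) X) \<longlonglongrightarrow> shift_entropy X"
proof -
  have "amenable TYPE('g)" using assms(3) by (auto simp: amenable_def)
  then show ?thesis
    using block_rate_limit[OF assms] shift_entropy_eq_INF[OF assms(1,2)] by simp
qed

lemma shift_entropy_nonneg:
  fixes X :: "('g::group_add \<Rightarrow> 'a) set"
  assumes "shift_invariant X" "finite_alphabet X A" "amenable TYPE('g)"
  shows "shift_entropy X \<ge> 0"
proof -
  have "{0} \<in> {K :: 'g set. finite K \<and> K \<noteq> {}}" by simp
  then show ?thesis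
    unfolding shift_entropy_eq_INF[OF assms] using block_rate_nonneg[OF assms(2)]
    by (intro cINF_greatest) auto
qed

text \<open>
  The limits are compared directly; the case of an empty \<open>X\<close> fits in because \<open>ln 0 = 0\<close>.
\<close>

lemma shift_entropy_mono:
  fixes X Y :: "('g::group_add \<Rightarrow> 'a) set"
  assumes "shift_invariant X" "shift_invariant Y" "finite_alphabet Y A" "amenable TYPE('g)" "X \<subseteq> Y"
  shows "shift_entropy X \<le> shift_entropy Y"
proof -
  obtain F :: "nat \<Rightarrow> 'g set" where F: "folner_sequence F"
    using assms(4) by (auto simp: amenable_def)
  have X: "finite_alphabet X A" using assms(3,5) by (rule finite_alphabet_subset)
  have le: "block_rate K X \<le> block_rate K Y" if "finite K" for K
  proof (cases "X = {}")
    case True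
    then have "block_rate K X = 0" by (simp add: block_rate_def block_count_def)
    then show ?thesis using block_rate_nonneg[OF assms(3) that] by simp
  next
    case False
    then show ?thesis
      using finite_alphabet.block_count_pos[OF X that False] that
        finite_alphabet.block_count_mono_set[OF assms(3) that assms(5)]
      by (auto simp: block_rate_def intro!: divide_right_mono)
  qed
  show ?thesis
    using block_rate_tendsto_shift_entropy[OF assms(1) X F]
      block_rate_tendsto_shift_entropy[OF assms(2,3) F]
    by (rule LIMSEQ_le) (use le F in \<open>auto simp: folner_sequence_finite\<close>)
qed

section \<open>Tile layers\<close>

text \<open>
  A layer \<open>y\<close> puts a copy \<open>F + c\<close> of \<open>F\<close> at every \<open>c\<close> with \<open>0 < y c\<close>.  The tile at \<open>c\<close> is the part of
  this copy that no copy with a smaller label meets, moved back by \<open>c\<close> into \<open>F\<close>: the copy at \<open>c'\<close>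
  contains \<open>f + c\<close> iff \<open>c' = - f' + f + c\<close> for some \<open>f' \<in> F\<close>.  The tile shapes are functions of the
  labelled centres, so recording the labels is enough; free shapes would carry too much entropy.
\<close>

definition tile :: "'g::group_add set \<Rightarrow> ('g \<Rightarrow> nat) \<Rightarrow> 'g \<Rightarrow> 'g set" where
  "tile F y c = {f\<in>F. \<forall>f'\<in>F. \<not> (0 < y (- f' + f + c) \<and> y (- f' + f + c) < y c)}"

definition covered :: "'g::group_add set \<Rightarrow> ('g \<Rightarrow> nat) \<Rightarrow> 'g set" where
  "covered F y = {h. \<exists>f\<in>F. 0 < y (- f + h)}"

text \<open>
  Overlapping copies have different labels, so that tiles are disjoint.  The last condition makes
  at least half of every translate of \<open>F\<close> covered.
\<close>

definition tile_rule :: "'g::group_add set \<Rightarrow> nat \<Rightarrow> ('g \<Rightarrow> nat) \<Rightarrow> 'g \<Rightarrow> bool" where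
  "tile_rule F L y c \<longleftrightarrow> y c \<le> L \<and>
     (0 < y c \<longrightarrow> card F \<le> 2 * card (tile F y c)) \<and>
     (\<forall>f\<in>F. \<forall>f'\<in>F. 0 < y c \<and> f \<noteq> f' \<longrightarrow> y (- f' + f + c) \<noteq> y c) \<and>
     card F \<le> 2 * card {f\<in>F. f + c \<in> covered F y}"

definition tile_layers :: "'g::group_add set \<Rightarrow> nat \<Rightarrow> ('g \<Rightarrow> nat) set" where
  "tile_layers F L = {y. \<forall>c. tile_rule F L y c}"

text \<open>
  With \<open>N\<close> containing all differences of two points of a window, a window that meets the core
  of a tile lies in the tile.  The rest \<open>T - core N T\<close> is called the ring of \<open>T\<close>.
\<close>

definition core :: "'g::group_add set \<Rightarrow> 'g set \<Rightarrow> 'g set" where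
  "core N T = {t\<in>T. \<forall>n\<in>N. n + t \<in> T}"

lemma tile_subset: "tile F y c \<subseteq> F"
  by (auto simp: tile_def)

lemma core_subset: "core N T \<subseteq> T"
  by (auto simp: core_def)

lemma tile_shift: "tile F (shift g y) c = tile F y (c + g)"
  by (simp add: tile_def shift_def add.assoc)

lemma tile_rule_shift: "tile_rule F L (shift g y) c = tile_rule F L y (c + g)"
  by (simp add: tile_rule_def tile_shift covered_def) (simp add: shift_def add.assoc)

lemma minus_plus_eq_iff: "- a + b = c \<longleftrightarrow> b = a + (c :: 'g::group_add)"
  by (metis add.assoc add.left_inverse add.right_inverse add_0)

text \<open>
  Colour greedily along an enumeration of the group: when \<open>x\<close> is reached, at most \<open>card \<Delta>\<close>
  colours are forbidden.
\<close>

lemma bounded_proper_colouring: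
  fixes \<Delta> :: "'g::group_add set"
  assumes "countable (UNIV :: 'g set)" "finite \<Delta>" "0 \<notin> \<Delta>" "\<And>d. d \<in> \<Delta> \<Longrightarrow> - d \<in> \<Delta>"
  obtains col :: "'g \<Rightarrow> nat" where "\<And>g. col g \<le> card \<Delta>" "\<And>g d. d \<in> \<Delta> \<Longrightarrow> col (d + g) \<noteq> col g"
proof -
  define idx where "idx = to_nat_on (UNIV :: 'g set)"
  have inj: "idx g = idx h \<Longrightarrow> g = h" for g h
    using inj_on_to_nat_on[OF assms(1)] by (simp add: idx_def inj_on_def)
  define P where "P f x r \<longleftrightarrow> r \<le> card \<Delta> \<and> (\<forall>d\<in>\<Delta>. idx (d + x) < idx x \<longrightarrow> r \<noteq> f (d + x))"
    for f :: "'g \<Rightarrow> nat" and x r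
  have "\<exists>f. \<forall>x. P f x (f x)"
  proof (rule dependent_wf_choice[of "inv_image less_than idx"])
    show "wf (inv_image less_than idx)" by (simp add: wf_inv_image)
  next
    fix r f g x
    assume "\<And>z. (z, x) \<in> inv_image less_than idx \<Longrightarrow> f z = (g z :: nat)"
    then show "P f x r = P g x r" by (auto simp: P_def)
  next
    fix x and f :: "'g \<Rightarrow> nat"
    have "card ((\<lambda>d. f (d + x)) ` \<Delta>) < card {..card \<Delta>}"
      using card_image_le[OF assms(2), of "\<lambda>d. f (d + x)"] by simp
    then have "\<not> {..card \<Delta>} \<subseteq> (\<lambda>d. f (d + x)) ` \<Delta>"
      using card_mono[of "(\<lambda>d. f (d + x)) ` \<Delta>" "{..card \<Delta>}"] assms(2) by auto
    then show "\<exists>r. P f x r" by (auto simp: P_def)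
  qed
  then obtain col where col: "\<And>x. P col x (col x)" by blast
  have "col (d + g) \<noteq> col g" if d: "d \<in> \<Delta>" for g d
  proof -
    have "d + g \<noteq> 0 + g" unfolding add_right_cancel using d assms(3) by blast
    then have "d + g \<noteq> g" by simp
    then have "idx (d + g) \<noteq> idx g" using inj by blast
    moreover have undo: "- d + (d + g) = g" by (simp add: add.assoc[symmetric])
    ultimately consider "idx (d + g) < idx g" | "idx (- d + (d + g)) < idx (d + g)"
      unfolding undo using nat_neq_iff by blast
    then show ?thesis
    proof cases
      case 1 then show ?thesis using col[of g] d by (auto simp: P_def)
    next
      case 2
      then have "col (d + g) \<noteq> col (- d + (d + g))"
        using col[of "d + g"] assms(4)[OF d] unfolding P_def by blast
      then show ?thesis unfolding undo .
    qed
  qed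
  moreover have "col g \<le> card \<Delta>" for g using col[of g] by (simp add: P_def)
  ultimately show ?thesis using that by blast
qed

text \<open>
  Colour the group so that overlapping translates of \<open>F\<close> get different colours, and treat the
  colours one after another: a translate is accepted if at least half of it is still free.
  A rejected translate is half covered already.  There are fewer than \<open>card F ^ 2\<close>
  differences of distinct elements of \<open>F\<close>, which bounds the labels.
\<close>

lemma tile_layers_nonempty:
  fixes F :: "'g::group_add set"
  assumes "countable (UNIV :: 'g set)" "finite F" "F \<noteq> {}"
  shows "tile_layers F (card F ^ 2) \<noteq> {}"
proof -
  define \<Delta> where "\<Delta> = (\<lambda>(f, f'). - f' + f) ` (F \<times> F - Id)"
  have "0 \<notin> \<Delta>" by (auto simp: \<Delta>_def minus_plus_eq_iff)
  moreover have "- d \<in> \<Delta>" if "d \<in> \<Delta>" for d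
  proof -
    from that obtain f f' where "f \<in> F" "f' \<in> F" "f \<noteq> f'" "d = - f' + f" by (auto simp: \<Delta>_def)
    then have "- d = (\<lambda>(f, f'). - f' + f) (f', f)" "(f', f) \<in> F \<times> F - Id" by (auto simp: minus_add)
    then show ?thesis unfolding \<Delta>_def by (rule image_eqI)
  qed
  moreover have "finite \<Delta>" using assms by (simp add: \<Delta>_def)
  ultimately obtain col :: "'g \<Rightarrow> nat" where
    col: "\<And>g. col g \<le> card \<Delta>" "\<And>g d. d \<in> \<Delta> \<Longrightarrow> col (d + g) \<noteq> col g"
    using bounded_proper_colouring[OF assms(1), of \<Delta>] by blast
  have "card \<Delta> < card F ^ 2"
  proof -
    obtain f where "f \<in> F" using assms(3) by blast
    have "card \<Delta> \<le> card (F \<times> F - Id)" unfolding \<Delta>_def using assms by (intro card_image_le) simp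
    also have "\<dots> < card (F \<times> F)" using \<open>f \<in> F\<close> assms by (intro psubset_card_mono) auto
    finally show ?thesis using assms by (simp add: power2_eq_square card_cartesian_product)
  qed
  then have colL: "Suc (col g) \<le> card F ^ 2" for g using col(1)[of g] by simp
  define free where "free W c = {f\<in>F. f + c \<notin> W}" for W c
  \<comment> \<open>\<open>cov i\<close> is the union of the accepted translates with colours below \<open>i\<close>.\<close>
  define cov where "cov = rec_nat {} (\<lambda>i W. W \<union> {h. \<exists>f\<in>F. col (- f + h) = i \<and> card F \<le> 2 * card (free W (- f + h))})"
  have cov0: "cov 0 = {}" and covS: "cov (Suc i) = cov i \<union> {h. \<exists>f\<in>F. col (- f + h) = i \<and> card F \<le> 2 * card (free (cov i) (- f + h))}" for i
    by (simp_all add: cov_def)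
  define y where "y c = (if card F \<le> 2 * card (free (cov (col c)) c) then Suc (col c) else 0)" for c
  have ypos: "0 < y c \<longleftrightarrow> card F \<le> 2 * card (free (cov (col c)) c)" and yval: "0 < y c \<Longrightarrow> y c = Suc (col c)" for c
    by (auto simp: y_def split: if_splits)
  have cov: "cov i = {h. \<exists>f\<in>F. 0 < y (- f + h) \<and> y (- f + h) \<le> i}" for i
  proof (induction i)
    case 0 then show ?case by (auto simp: cov0)
  next
    case (Suc i)
    have new: "col c = i \<and> card F \<le> 2 * card (free (cov i) c) \<longleftrightarrow> 0 < y c \<and> y c = Suc i" for c
      by (auto simp: y_def split: if_splits)
    have "cov (Suc i) = cov i \<union> {h. \<exists>f\<in>F. 0 < y (- f + h) \<and> y (- f + h) = Suc i}"
      by (simp only: covS new)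
    then show ?case unfolding Suc by (auto simp: le_Suc_eq)
  qed
  have tile: "tile F y c = free (cov (col c)) c" if "0 < y c" for c
    using yval[OF that] by (auto simp: tile_def free_def cov add.assoc less_Suc_eq_le)
  have "tile_rule F (card F ^ 2) y c" for c
    unfolding tile_rule_def
  proof (intro conjI ballI impI)
    show "y c \<le> card F ^ 2" using colL by (simp add: y_def)
    show "card F \<le> 2 * card (tile F y c)" if "0 < y c" using tile[OF that] ypos[of c] that by simp
    show "y (- f' + f + c) \<noteq> y c" if "f \<in> F" "f' \<in> F" "0 < y c \<and> f \<noteq> f'" for f f'
    proof
      assume eq: "y (- f' + f + c) = y c"
      then have "col (- f' + f + c) = col c" using yval[of c] yval[of "- f' + f + c"] that by simp
      moreover have "(\<lambda>(f, f'). - f' + f) (f, f') \<in> \<Delta>" unfolding \<Delta>_def using that by (intro imageI) auto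
      ultimately show False using col(2)[of "- f' + f" c] by simp
    qed
    show "card F \<le> 2 * card {f\<in>F. f + c \<in> covered F y}"
    proof (cases "0 < y c")
      case True
      then have "{f\<in>F. f + c \<in> covered F y} = F" by (force simp: covered_def add.assoc[symmetric])
      then show ?thesis by simp
    next
      case False
      have "card F = card (free (cov (col c)) c) + card {f\<in>F. f + c \<in> cov (col c)}"
        using assms by (subst card_Un_disjoint[symmetric]) (auto simp: free_def intro!: arg_cong[where f = card])
      moreover have "2 * card (free (cov (col c)) c) < card F" using False ypos[of c] by simp
      moreover have "card {f\<in>F. f + c \<in> cov (col c)} \<le> card {f\<in>F. f + c \<in> covered F y}"
        using assms by (intro card_mono) (auto simp: cov covered_def)
      ultimately show ?thesis by simp
    qed
  qed
  then show ?thesis by (auto simp: tile_layers_def)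
qed

locale tile_layer =
  fixes F :: "'g::group_add set" and L :: nat and y :: "'g \<Rightarrow> nat"
  assumes finite_F: "finite F" and F_nonempty: "F \<noteq> {}" and layer: "y \<in> tile_layers F L"
begin

lemma tile_rule: "tile_rule F L y c"
  using layer by (simp add: tile_layers_def)

lemma finite_tile: "finite (tile F y c)"
  by (rule finite_subset[OF tile_subset finite_F])

lemma tile_large: "0 < y c \<Longrightarrow> card F \<le> 2 * card (tile F y c)"
  using tile_rule[of c] by (simp add: tile_rule_def)

lemma tiles_disjoint:
  assumes "0 < y c" "0 < y c'" "t \<in> tile F y c" "t' \<in> tile F y c'" "t + c = t' + c'"
  shows "c = c'"
proof (rule ccontr)
  assume ne: "c \<noteq> c'"
  have c': "c' = - t' + t + c" and c: "c = - t + t' + c'"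
    using assms(5) by (metis add.assoc minus_plus_eq_iff)+
  have tF: "t \<in> F" "t' \<in> F" using assms tile_subset by blast+
  have "t \<noteq> t'" using ne assms(5) by auto
  then have "y c' \<noteq> y c" using tile_rule[of c] tF assms(1) c' by (auto simp: tile_rule_def)
  moreover have "\<not> y c' < y c" using assms(2,3) tF(2) c' by (auto simp: tile_def)
  moreover have "\<not> y c < y c'" using assms(1,4) tF(1) c by (auto simp: tile_def)
  ultimately show False by simp
qed

text \<open>
  Among the copies of \<open>F\<close> that contain \<open>h\<close>, the one with the smallest label keeps \<open>h\<close>.
\<close>

lemma covered_by_tile:
  assumes "h \<in> covered F y"
  obtains c t where "0 < y c" "t \<in> tile F y c" "h = t + c"
proof -
  let ?Q = "\<lambda>f. f \<in> F \<and> 0 < y (- f + h)"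
  obtain f0 where "?Q f0" using assms by (auto simp: covered_def)
  then obtain f where f: "?Q f" "\<And>f'. ?Q f' \<Longrightarrow> y (- f + h) \<le> y (- f' + h)"
    using ex_has_least_nat[of ?Q f0 "\<lambda>f. y (- f + h)"] by blast
  have h: "f + (- f + h) = h" by (simp add: add.assoc[symmetric])
  have "f \<in> tile F y (- f + h)"
    using f by (fastforce simp: tile_def add.assoc h)
  then show ?thesis using that[of "- f + h" f] f h by simp
qed

lemma card_disjoint_translates:
  assumes "finite C" "\<And>c. c \<in> C \<Longrightarrow> 0 < y c" "\<And>c. S c \<subseteq> tile F y c"
  shows "card (\<Union>c\<in>C. (\<lambda>t. t + c) ` S c) = (\<Sum>c\<in>C. card (S c))"
proof -
  have "card (\<Union>c\<in>C. (\<lambda>t. t + c) ` S c) = (\<Sum>c\<in>C. card ((\<lambda>t. t + c) ` S c))"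
  proof (rule card_UN_disjoint)
    show "\<forall>c\<in>C. finite ((\<lambda>t. t + c) ` S c)"
      using finite_subset[OF assms(3) finite_tile] by simp
    show "\<forall>i\<in>C. \<forall>j\<in>C. i \<noteq> j \<longrightarrow> (\<lambda>t. t + i) ` S i \<inter> (\<lambda>t. t + j) ` S j = {}"
      using tiles_disjoint assms(2,3) by blast
  qed fact
  also have "\<dots> = (\<Sum>c\<in>C. card (S c))"
    by (intro sum.cong refl card_image) (auto simp: inj_on_def)
  finally show ?thesis .
qed

text \<open>
  The tiles at the centres in \<open>C\<close> are disjoint, lie in \<open>F + Q\<close>, and have at least half the size of
  \<open>F\<close> each.
\<close>

lemma card_centres_le:
  assumes "finite Q" "C \<subseteq> Q" "\<And>c. c \<in> C \<Longrightarrow> 0 < y c"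
  shows "card C * card F \<le> 2 * card (F + Q)"
proof -
  have fC: "finite C" by (rule finite_subset[OF assms(2,1)])
  have "card C * card F = (\<Sum>c\<in>C. card F)" by simp
  also have "\<dots> \<le> (\<Sum>c\<in>C. 2 * card (tile F y c))"
    using tile_large assms(3) by (intro sum_mono) auto
  also have "\<dots> = 2 * card (\<Union>c\<in>C. (\<lambda>t. t + c) ` tile F y c)"
    using card_disjoint_translates[OF fC assms(3), of "tile F y"] by (simp add: sum_distrib_left)
  also have "\<dots> \<le> 2 * card (F + Q)"
    using assms finite_F tile_subset by (intro mult_left_mono card_mono finite_set_plus) blast+
  finally show ?thesis .
qed

definition inner_centres :: "'g set \<Rightarrow> 'g set" where
  "inner_centres E = {c. 0 < y c \<and> (\<forall>f\<in>F. f + c \<in> E)}"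

lemma inner_centres_subset: "inner_centres E \<subseteq> uminus ` F + E"
proof
  fix c assume c: "c \<in> inner_centres E"
  obtain f where "f \<in> F" using F_nonempty by blast
  then have "f + c \<in> E" "c = - f + (f + c)" using c by (auto simp: inner_centres_def add.assoc[symmetric])
  then show "c \<in> uminus ` F + E" using \<open>f \<in> F\<close> by (metis imageI set_plus_intro)
qed

lemma finite_inner_centres: "finite E \<Longrightarrow> finite (inner_centres E)"
  by (rule finite_subset[OF inner_centres_subset]) (simp add: finite_F finite_set_plus)

text \<open>
  Averaging the covering rule over the translates of \<open>F\<close> inside \<open>E\<close> shows that almost half of \<open>E\<close> is
  covered.  Points covered from a copy of \<open>F\<close> that sticks out of \<open>E\<close> are few, since such a copy
  has its centre near the boundary of \<open>E\<close>; the factor \<open>card F\<close> in the condition on \<open>\<delta>\<close> pays for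
  the size of these copies.
\<close>

lemma tiles_cover_quarter:
  assumes E: "almost_invariant (F \<union> uminus ` F) \<delta> E" and \<delta>: "\<delta> * card F \<le> 1 / 16"
  shows "real (card E) \<le> 4 * (\<Sum>c\<in>inner_centres E. real (card (tile F y c)))"
proof -
  have fE: "finite E" "E \<noteq> {}" using E by (auto simp: almost_invariant_def)
  have EF: "almost_invariant F \<delta> E" "almost_invariant (uminus ` F) \<delta> E"
    using E finite_F by (auto elim!: almost_invariant_mono)
  have cF: "card F \<ge> 1" using finite_F F_nonempty by (simp add: Suc_le_eq card_gt_0_iff)
  define G0 where "G0 = {g\<in>E. \<forall>f\<in>F. f + g \<in> E}"
  define bad where "bad = (uminus ` F + E) - {c. \<forall>f\<in>F. f + c \<in> E}"
  define U where "U = (\<Union>c\<in>inner_centres E. (\<lambda>t. t + c) ` tile F y c)"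
  have fin: "finite G0" "finite bad" "finite (uminus ` F + E)" "finite (F + bad)"
    using fE finite_F by (auto simp: G0_def bad_def finite_set_plus)
  have fU: "finite U" unfolding U_def using finite_inner_centres[OF fE(1)] finite_tile by blast
  have G0: "real (card E) \<le> card G0 + \<delta> * card E"
  proof -
    have "card E = card G0 + card {e\<in>E. \<exists>k\<in>F. k + e \<notin> E}"
      using fE by (subst card_Un_disjoint[symmetric]) (auto simp: G0_def intro!: arg_cong[where f = card])
    then show ?thesis using EF(1) by (simp add: almost_invariant_def)
  qed
  have bad: "real (card bad) \<le> 2 * \<delta> * card E"
  proof -
    have "card bad \<le> card ((uminus ` F + E - E) \<union> {e\<in>E. \<exists>k\<in>F. k + e \<notin> E})"
      using fin fE by (intro card_mono) (auto simp: bad_def)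
    also have "\<dots> \<le> card (uminus ` F + E - E) + card {e\<in>E. \<exists>k\<in>F. k + e \<notin> E}" by (rule card_Un_le)
    finally show ?thesis using EF by (simp add: almost_invariant_def)
  qed
  have "card G0 * card F = (\<Sum>g\<in>G0. card F)" by simp
  also have "\<dots> \<le> (\<Sum>g\<in>G0. 2 * card {f\<in>F. f + g \<in> covered F y})"
    using tile_rule by (intro sum_mono) (simp add: tile_rule_def)
  also have "\<dots> = 2 * (\<Sum>g\<in>G0. \<Sum>f\<in>F. if f + g \<in> covered F y then 1 else 0)"
    using finite_F by (simp add: sum_distrib_left sum.If_cases Collect_conj_eq)
  also have "\<dots> = 2 * (\<Sum>f\<in>F. card {g\<in>G0. f + g \<in> covered F y})"
    using fin by (subst sum.swap) (simp add: sum.If_cases Collect_conj_eq)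
  also have "\<dots> \<le> 2 * (\<Sum>f\<in>F. card (covered F y \<inter> E))"
  proof (intro mult_left_mono sum_mono)
    fix f assume "f \<in> F"
    then show "card {g\<in>G0. f + g \<in> covered F y} \<le> card (covered F y \<inter> E)"
      using fE by (intro card_inj_on_le[where f = "\<lambda>g. f + g"]) (auto simp: inj_on_def G0_def)
  qed simp
  also have "\<dots> = 2 * card (covered F y \<inter> E) * card F" by simp
  finally have "card G0 \<le> 2 * card (covered F y \<inter> E)" using cF by simp
  moreover have "card (covered F y \<inter> E) \<le> card U + card F * card bad"
  proof -
    have "covered F y \<inter> E \<subseteq> U \<union> (F + bad)"
    proof
      fix h assume h: "h \<in> covered F y \<inter> E"
      then obtain c t where c: "0 < y c" "t \<in> tile F y c" "h = t + c" using covered_by_tile by blast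
      have tF: "t \<in> F" using c(2) tile_subset by blast
      show "h \<in> U \<union> (F + bad)"
      proof (cases "c \<in> inner_centres E")
        case True then show ?thesis using c by (auto simp: U_def)
      next
        case False
        have "c = - t + h" using c(3) by (simp add: add.assoc[symmetric])
        then have "c \<in> uminus ` F + E" using h tF by blast
        then have "c \<in> bad" using False c(1) by (auto simp: bad_def inner_centres_def)
        then show ?thesis using c(3) tF by blast
      qed
    qed
    then have "card (covered F y \<inter> E) \<le> card (U \<union> (F + bad))"
      using fU fin by (intro card_mono) auto
    also have "\<dots> \<le> card U + card (F + bad)" by (rule card_Un_le)
    also have "F + bad = (\<lambda>(f, c). f + c) ` (F \<times> bad)" by (auto simp: set_plus_def)
    also have "card \<dots> \<le> card (F \<times> bad)" using fin finite_F by (intro card_image_le) auto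
    finally show ?thesis by (simp add: card_cartesian_product)
  qed
  moreover have "card U = (\<Sum>c\<in>inner_centres E. card (tile F y c))"
    unfolding U_def using finite_inner_centres[OF fE(1)]
    by (intro card_disjoint_translates) (auto simp: inner_centres_def)
  ultimately have "card G0 \<le> 2 * (\<Sum>c\<in>inner_centres E. card (tile F y c)) + 2 * (card F * card bad)" by linarith
  from of_nat_mono[where 'a = real, OF this] have "real (card G0) \<le> 2 * (\<Sum>c\<in>inner_centres E. real (card (tile F y c))) + 2 * (card F * real (card bad))"
    by simp
  moreover have "card F * real (card bad) \<le> card F * (2 * \<delta> * card E)"
    using bad by (intro mult_left_mono) auto
  moreover have "card F * (2 * \<delta> * card E) \<le> card E / 8"
    using mult_right_mono[OF \<delta>, of "2 * real (card E)"] by (simp add: mult_ac)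
  moreover have "\<delta> * card E \<le> card E / 16"
  proof -
    have "\<delta> \<ge> 0"
      using EF(1) fE by (auto simp: almost_invariant_def card_gt_0_iff zero_le_mult_iff dest!: order_trans[OF of_nat_0_le_iff])
    then have "\<delta> \<le> \<delta> * card F" using cF by (simp add: mult_le_cancel_left1)
    then show ?thesis using \<delta> mult_right_mono[of \<delta> "1/16" "real (card E)"] by simp
  qed
  ultimately show ?thesis using G0 by linarith
qed

text \<open>
  A single tile may be ragged, but all rings together are small: a ring point of a tile
  is either near the boundary of its own copy of \<open>F\<close>, or just outside the copy that cut the tile.
  Every copy is charged for its inner and its outer boundary, and there are few copies.
\<close>

lemma tile_rings_small:
  assumes fN: "finite N" and F: "almost_invariant (N \<union> uminus ` N) \<epsilon> F"
    and E: "finite E" "card (F + (uminus ` F + E)) \<le> 2 * card E"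
      "card (F + (uminus ` F + (N + E))) \<le> 2 * card E"
  shows "(\<Sum>c\<in>inner_centres E. real (card (tile F y c - core N (tile F y c)))) \<le> 8 * \<epsilon> * card E"
proof -
  have FN: "almost_invariant N \<epsilon> F" "almost_invariant (uminus ` N) \<epsilon> F"
    using F fN by (auto elim!: almost_invariant_mono)
  have cF: "card F > 0" using finite_F F_nonempty by (simp add: card_gt_0_iff)
  have eps: "\<epsilon> \<ge> 0"
    using F cF by (auto simp: almost_invariant_def zero_le_mult_iff dest!: order_trans[OF of_nat_0_le_iff])
  define rim where "rim = {f\<in>F. \<exists>n\<in>N. n + f \<notin> F}"
  define fringe where "fringe = uminus ` N + F - F"
  define C' where "C' = {c \<in> uminus ` F + (N + E). 0 < y c}"
  let ?C = "inner_centres E"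
  have fin: "finite ?C" "finite C'" "finite rim" "finite fringe"
    using finite_inner_centres[OF E(1)] E fN finite_F by (auto simp: C'_def rim_def fringe_def finite_set_plus)
  have "(\<Sum>c\<in>?C. card (tile F y c - core N (tile F y c)))
      = card (\<Union>c\<in>?C. (\<lambda>t. t + c) ` (tile F y c - core N (tile F y c)))"
    using fin by (intro card_disjoint_translates[symmetric]) (auto simp: inner_centres_def)
  also have "\<dots> \<le> card ((\<Union>c\<in>?C. (\<lambda>t. t + c) ` rim) \<union> (\<Union>c\<in>C'. (\<lambda>t. t + c) ` fringe))"
  proof (intro card_mono subsetI)
    fix z assume "z \<in> (\<Union>c\<in>?C. (\<lambda>t. t + c) ` (tile F y c - core N (tile F y c)))"
    then obtain c t where c: "c \<in> ?C" "t \<in> tile F y c" "t \<notin> core N (tile F y c)" "z = t + c" by blast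
    then obtain n where n: "n \<in> N" "n + t \<notin> tile F y c" by (auto simp: core_def)
    have tF: "t \<in> F" using c(2) tile_subset by blast
    show "z \<in> (\<Union>c\<in>?C. (\<lambda>t. t + c) ` rim) \<union> (\<Union>c\<in>C'. (\<lambda>t. t + c) ` fringe)"
    proof (cases "n + t \<in> F")
      case False
      then have "t \<in> rim" using n tF by (auto simp: rim_def)
      then show ?thesis using c by blast
    next
      case True
      then obtain f' where f': "f' \<in> F" "0 < y (- f' + (n + t) + c)" "y (- f' + (n + t) + c) < y c"
        using n(2) by (auto simp: tile_def)
      define c' where "c' = - f' + (n + t) + c"
      have zE: "z \<in> E" using c tF by (auto simp: inner_centres_def)
      have c'_eq: "c' = - f' + (n + z)" using c(4) by (simp add: c'_def add.assoc)
      then have "c' \<in> C'" using f' n zE by (auto simp: C'_def c'_def[symmetric])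
      have z: "z = (- n + f') + c'" by (simp add: c'_eq add.assoc[symmetric])
      have "- n + f' \<notin> F"
      proof
        assume "- n + f' \<in> F"
        moreover have "- (- n + f') + t + c = c'" using c(4) z by (simp add: add.assoc minus_plus_eq_iff)
        ultimately show False using c(2) f' by (force simp: tile_def c'_def[symmetric])
      qed
      then have "- n + f' \<in> fringe" using n f' by (auto simp: fringe_def)
      then show ?thesis using \<open>c' \<in> C'\<close> z by blast
    qed
  qed (use fin in auto)
  also have "\<dots> \<le> (\<Sum>c\<in>?C. card ((\<lambda>t. t + c) ` rim)) + (\<Sum>c\<in>C'. card ((\<lambda>t. t + c) ` fringe))"
    using fin by (intro order_trans[OF card_Un_le] add_mono card_UN_le)
  also have "\<dots> \<le> (\<Sum>c\<in>?C. card rim) + (\<Sum>c\<in>C'. card fringe)"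
    using fin by (intro add_mono sum_mono card_image_le)
  finally have "(\<Sum>c\<in>?C. card (tile F y c - core N (tile F y c))) \<le> card ?C * card rim + card C' * card fringe"
    by simp
  from of_nat_mono[where 'a = real, OF this] have "(\<Sum>c\<in>?C. real (card (tile F y c - core N (tile F y c)))) \<le> card ?C * real (card rim) + card C' * real (card fringe)"
    by simp
  also have "\<dots> \<le> card ?C * (\<epsilon> * card F) + card C' * (\<epsilon> * card F)"
    using FN by (intro add_mono mult_left_mono) (auto simp: almost_invariant_def rim_def fringe_def)
  also have "\<dots> = \<epsilon> * (real (card ?C * card F) + real (card C' * card F))"
    by (simp add: algebra_simps)
  also have "\<dots> \<le> \<epsilon> * (4 * real (card E) + 4 * real (card E))"
  proof (intro mult_left_mono add_mono eps)
    have "card ?C * card F \<le> 2 * card (F + (uminus ` F + E))"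
      using inner_centres_subset E finite_F
      by (intro card_centres_le finite_set_plus) (auto simp: inner_centres_def)
    then show "real (card ?C * card F) \<le> 4 * real (card E)" using E(2) by linarith
    have "card C' * card F \<le> 2 * card (F + (uminus ` F + (N + E)))"
      using E finite_F fN by (intro card_centres_le finite_set_plus) (auto simp: C'_def)
    then show "real (card C' * card F) \<le> 4 * real (card E)" using E(3) by linarith
  qed
  finally show ?thesis by simp
qed

end

text \<open>
  Weigh every subset \<open>D\<close> by \<open>s ^ card D\<close>; the total weight of all subsets of \<open>R\<close> is
  \<open>(1 + s) ^ card R\<close>.
\<close>

lemma card_small_subsets_le:
  fixes s :: real
  assumes "finite R" "0 < s" "s \<le> 1"
  shows "real (card {D. D \<subseteq> R \<and> card D \<le> m}) \<le> exp (m * ln (1 / s) + s * card R)"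
proof -
  have "real (card {D. D \<subseteq> R \<and> card D \<le> m}) * s ^ m = (\<Sum>D | D \<subseteq> R \<and> card D \<le> m. s ^ m)"
    by simp
  also have "\<dots> \<le> (\<Sum>D | D \<subseteq> R \<and> card D \<le> m. s ^ card D)"
    using assms by (intro sum_mono power_decreasing) auto
  also have "\<dots> \<le> (\<Sum>D\<in>Pow R. s ^ card D)"
    using assms by (intro sum_mono2) auto
  also have "\<dots> = (\<Prod>r\<in>R. s + 1)"
    using prod_add[OF assms(1), of "\<lambda>_. s" "\<lambda>_. 1"] by simp
  also have "\<dots> \<le> exp s ^ card R"
    using assms exp_ge_add_one_self[of s] by (simp add: add.commute power_mono)
  finally have "real (card {D. D \<subseteq> R \<and> card D \<le> m}) \<le> exp s ^ card R / s ^ m"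
    using assms by (simp add: field_simps)
  also have "\<dots> = exp (m * ln (1 / s) + s * card R)"
    using assms by (simp add: exp_add exp_of_nat_mult exp_of_nat2_mult power_divide field_simps)
  finally show ?thesis .
qed

section \<open>Exchanging patterns inside tiles\<close>

text \<open>
  A shift of finite type \<open>X\<close> together with a block code \<open>\<phi>\<close>.  One window \<open>M\<close> serves for both:
  a configuration that looks like a point of \<open>X\<close> through every translate of \<open>M\<close> is in \<open>X\<close>, and the
  symbols seen through \<open>M\<close> determine the image symbol.
\<close>

locale coded_shift =
  fixes X :: "('g::group_add \<Rightarrow> 'b) set" and B :: "'b set" and A :: "'a set"
    and \<phi> :: "('g \<Rightarrow> 'b) \<Rightarrow> ('g \<Rightarrow> 'a)" and M :: "'g set"
  assumes alphabet_X: "finite_alphabet X B"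
    and alphabet_image: "finite_alphabet (\<phi> ` X) A"
    and invariant_X: "shift_invariant X"
    and window: "finite M" "0 \<in> M"
    and gluing: "\<And>z. (\<And>g. \<exists>x\<in>X. \<forall>m\<in>M. z (m + g) = x (m + g)) \<Longrightarrow> z \<in> X"
    and block_code: "\<And>x x'. \<lbrakk>x \<in> X; x' \<in> X; \<forall>m\<in>M. x m = x' m\<rbrakk> \<Longrightarrow> \<phi> x 0 = \<phi> x' 0"
    and equivariant: "\<And>x g. x \<in> X \<Longrightarrow> \<phi> (shift g x) = shift g (\<phi> x)"
begin

lemma block_code_at:
  assumes "x \<in> X" "x' \<in> X" "\<And>m. m \<in> M \<Longrightarrow> x (m + g) = x' (m + h)"
  shows "\<phi> x g = \<phi> x' h"
proof -
  have "\<phi> (shift g x) 0 = \<phi> (shift h x') 0"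
    using assms invariant_X by (intro block_code) (auto simp: shift_invariant_def shift_def)
  then show ?thesis
    using assms by (simp add: equivariant) (simp add: shift_def)
qed

text \<open>
  Write \<open>q\<close> on all the tiles \<open>T + c\<close>.  A window that meets a core lies in its tile and sees a
  translate of \<open>q\<close>; every other window sees \<open>x\<close>, because \<open>q\<close> agrees with \<open>x\<close> on the rings.  For the same
  reason the image changes only at points whose window lies in one of the tiles.
\<close>

lemma exchange:
  assumes x: "x \<in> X" and q: "q \<in> X"
    and disj: "\<And>c c' t t'. \<lbrakk>c \<in> D; c' \<in> D; t \<in> T; t' \<in> T; t + c = t' + c'\<rbrakk> \<Longrightarrow> c = c'"
    and N: "\<And>m m'. m \<in> M \<Longrightarrow> m' \<in> M \<Longrightarrow> m' - m \<in> N"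
    and ring: "\<And>c t. c \<in> D \<Longrightarrow> t \<in> T - core N T \<Longrightarrow> x (t + c) = q t"
  shows "\<exists>z\<in>X. (\<forall>c\<in>D. \<forall>t\<in>T. z (t + c) = q t) \<and>
    (\<forall>g. (\<forall>c\<in>D. \<forall>t\<in>T. g \<noteq> t + c) \<longrightarrow> z g = x g) \<and>
    (\<forall>g. \<phi> x g \<noteq> \<phi> z g \<longrightarrow> (\<exists>c\<in>D. \<forall>m\<in>M. \<exists>t\<in>T. m + g = t + c))"
proof -
  define z where "z g = (if \<exists>c\<in>D. \<exists>t\<in>T. g = t + c then q (SOME t. t \<in> T \<and> (\<exists>c\<in>D. g = t + c)) else x g)" for g
  have z_in: "z (t + c) = q t" if "c \<in> D" "t \<in> T" for c t
  proof -
    have "(SOME t'. t' \<in> T \<and> (\<exists>c'\<in>D. t + c = t' + c')) = t"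
    proof (rule some_equality)
      fix t' assume "t' \<in> T \<and> (\<exists>c'\<in>D. t + c = t' + c')"
      then obtain c' where "t' \<in> T" "c' \<in> D" "t + c = t' + c'" by blast
      moreover from this have "c = c'" using disj that by blast
      ultimately show "t' = t" by simp
    qed (use that in blast)
    then show ?thesis using that by (auto simp: z_def)
  qed
  have z_out: "z g = x g" if "\<And>c t. c \<in> D \<Longrightarrow> t \<in> T \<Longrightarrow> g \<noteq> t + c" for g
    using that unfolding z_def by (auto)
  have near: "\<exists>c\<in>D. \<forall>m\<in>M. \<exists>t\<in>T. m + g = t + c" if m: "m \<in> M" and ne: "z (m + g) \<noteq> x (m + g)" for m g
  proof -
    obtain c t where c: "c \<in> D" "t \<in> T" "m + g = t + c" using z_out ne by blast
    have "t \<in> core N T"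
    proof (rule ccontr)
      assume "t \<notin> core N T"
      then have "x (t + c) = q t" using ring c by blast
      then show False using ne z_in c by simp
    qed
    moreover have "m' + g = (m' - m + t) + c" for m'
    proof -
      have "g = - m + (t + c)" by (simp add: c(3)[symmetric] add.assoc[symmetric])
      then show ?thesis by (simp add: add.assoc diff_conv_add_uminus del: add_uminus_conv_diff)
    qed
    ultimately show ?thesis using c(1) N[OF m] unfolding core_def by blast
  qed
  have "z \<in> X"
  proof (rule gluing)
    fix g
    show "\<exists>x\<in>X. \<forall>m\<in>M. z (m + g) = x (m + g)"
    proof (cases "\<exists>m\<in>M. z (m + g) \<noteq> x (m + g)")
      case True
      then obtain c where c: "c \<in> D" "\<forall>m\<in>M. \<exists>t\<in>T. m + g = t + c" using near by blast
      have "z (m + g) = shift (- c) q (m + g)" if m: "m \<in> M" for m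
      proof -
        obtain t where t: "t \<in> T" "m + g = t + c" using c(2) m by blast
        show ?thesis unfolding t(2) using z_in[OF c(1) t(1)] by (simp add: shift_def add.assoc)
      qed
      then show ?thesis using shift_invariantD[OF invariant_X q] by blast
    qed (use x in blast)
  qed
  moreover have "\<exists>c\<in>D. \<forall>m\<in>M. \<exists>t\<in>T. m + g = t + c" if "\<phi> x g \<noteq> \<phi> z g" for g
    using block_code_at[OF x \<open>z \<in> X\<close>, of g g] near that by metis
  ultimately show ?thesis using z_in z_out by (intro bexI[of _ z]) blast+
qed

definition admits :: "'g set \<Rightarrow> ('g \<Rightarrow> nat) \<Rightarrow> ('g \<rightharpoonup> 'b) set \<Rightarrow> ('g \<Rightarrow> 'b) \<Rightarrow> bool" where
  "admits F y S x \<longleftrightarrow> (\<forall>c. 0 < y c \<longrightarrow> restrict_config (shift c x) (tile F y c) \<in> S)"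

definition thinned :: "'g set \<Rightarrow> nat \<Rightarrow> ('g \<rightharpoonup> 'b) set \<Rightarrow> ('g \<Rightarrow> 'a) set" where
  "thinned F L S = \<phi> ` {x\<in>X. \<exists>y\<in>tile_layers F L. admits F y S x}"

lemma thinned_subset: "thinned F L S \<subseteq> \<phi> ` X"
  by (auto simp: thinned_def)

lemma alphabet_thinned: "finite_alphabet (thinned F L S) A"
  by (rule finite_alphabet_subset[OF alphabet_image thinned_subset])

text \<open>
  Exchange \<open>p\<close> for \<open>p'\<close> on all tiles of \<open>x\<close> that carry \<open>p\<close>, and let \<open>D\<close> be the set of their centres.
  The image \<open>u\<close> of \<open>x\<close> can be reconstructed on \<open>E\<close> from the new image \<open>u'\<close> and the part of \<open>D\<close> near
  \<open>E\<close>: where the window lies in a tile of \<open>D\<close>, the pattern \<open>p\<close> determines \<open>u\<close>, and elsewhere \<open>u\<close> and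
  \<open>u'\<close> agree.
\<close>

lemma block_count_remove_pattern:
  assumes F: "finite F" "F \<noteq> {}" and E: "finite E"
    and N: "\<And>m m'. m \<in> M \<Longrightarrow> m' \<in> M \<Longrightarrow> m' - m \<in> N"
    and p: "p' \<in> S" "p' \<noteq> p" "dom p = T" "T \<subseteq> F"
    and q: "q \<in> X" "p' = restrict_config q T"
    and ring: "\<And>t. t \<in> T - core N T \<Longrightarrow> p t = p' t"
    and m: "2 * card (F + (uminus ` F + E)) \<le> m * card F"
  shows "block_count E (thinned F L S)
    \<le> block_count E (thinned F L (S - {p})) * card {D. D \<subseteq> uminus ` F + E \<and> card D \<le> m}"
proof -
  let ?U = "thinned F L S" and ?U' = "thinned F L (S - {p})" and ?Q = "uminus ` F + E"
  \<comment> \<open>A witness for \<open>u\<close> consists of a preimage, the set of changed centres and the image after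
    the exchange.\<close>
  define good where "good u = (\<lambda>(x, D, u'). x \<in> X \<and> u = \<phi> x \<and> u' \<in> ?U' \<and> card (D \<inter> ?Q) \<le> m \<and>
      (\<forall>c\<in>D. \<forall>t\<in>T. Some (x (t + c)) = p t) \<and>
      (\<forall>g. u g \<noteq> u' g \<longrightarrow> (\<exists>c\<in>D. \<forall>m\<in>M. \<exists>t\<in>T. m + g = t + c)))" for u
  have cF: "card F > 0" using F by (simp add: card_gt_0_iff)
  have fQ: "finite ?Q" using F E by (simp add: finite_set_plus)
  have "\<exists>w. good u w" if u: "u \<in> ?U" for u
  proof -
    obtain x y where x: "x \<in> X" "u = \<phi> x" and y: "y \<in> tile_layers F L" and adm: "admits F y S x"
      using u by (auto simp: thinned_def)
    interpret tile_layer F L y using F y by unfold_locales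
    define D where "D = {c. 0 < y c \<and> restrict_config (shift c x) (tile F y c) = p}"
    have TD: "tile F y c = T" if "c \<in> D" for c
    proof -
      have "restrict_config (shift c x) (tile F y c) = p" using that by (simp add: D_def)
      then show ?thesis using dom_restrict_config[of "shift c x" "tile F y c"] p(3) by simp
    qed
    have xD: "Some (x (t + c)) = p t" if "c \<in> D" "t \<in> T" for c t
    proof -
      have "restrict_config (shift c x) (tile F y c) = p" using that(1) by (simp add: D_def)
      then have "p = restrict_config (shift c x) T" unfolding TD[OF that(1)] by (rule sym)
      then show ?thesis using that(2) by (simp add: restrict_config_apply shift_def)
    qed
    have disj: "c = c'" if "c \<in> D" "c' \<in> D" "t \<in> T" "t' \<in> T" "t + c = t' + c'" for c c' t t'
    proof (rule tiles_disjoint[of c c' t t'])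
      show "0 < y c" "0 < y c'" using that(1,2) by (simp_all add: D_def)
      show "t \<in> tile F y c" "t' \<in> tile F y c'" using that(3,4) TD[OF that(1)] TD[OF that(2)] by simp_all
    qed (rule that(5))
    have xq: "x (t + c) = q t" if "c \<in> D" "t \<in> T - core N T" for c t
    proof -
      have "Some (x (t + c)) = p t" using xD that by blast
      also have "\<dots> = Some (q t)" using ring that q by (simp add: restrict_config_apply)
      finally show ?thesis by simp
    qed
    have "\<exists>z\<in>X. (\<forall>c\<in>D. \<forall>t\<in>T. z (t + c) = q t) \<and>
        (\<forall>g. (\<forall>c\<in>D. \<forall>t\<in>T. g \<noteq> t + c) \<longrightarrow> z g = x g) \<and>
        (\<forall>g. \<phi> x g \<noteq> \<phi> z g \<longrightarrow> (\<exists>c\<in>D. \<forall>m\<in>M. \<exists>t\<in>T. m + g = t + c))"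
      by (rule exchange[OF x(1) q(1) disj N xq])
    then obtain z where z: "z \<in> X" "\<forall>c\<in>D. \<forall>t\<in>T. z (t + c) = q t"
      "\<forall>g. (\<forall>c\<in>D. \<forall>t\<in>T. g \<noteq> t + c) \<longrightarrow> z g = x g"
      "\<forall>g. \<phi> x g \<noteq> \<phi> z g \<longrightarrow> (\<exists>c\<in>D. \<forall>m\<in>M. \<exists>t\<in>T. m + g = t + c)"
      by blast
    have "admits F y (S - {p}) z"
      unfolding admits_def
    proof (intro allI impI)
      fix c assume c: "0 < y c"
      show "restrict_config (shift c z) (tile F y c) \<in> S - {p}"
      proof (cases "c \<in> D")
        case True
        have "restrict_config (shift c z) (tile F y c) = p'"
          unfolding TD[OF True] q(2) using z(2) True by (simp add: restrict_config_eq_iff shift_def)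
        then show ?thesis using p by simp
      next
        case False
        have "z (t + c) = x (t + c)" if "t \<in> tile F y c" for t
        proof (rule z(3)[rule_format])
          fix c' t' assume c': "c' \<in> D" "t' \<in> T"
          have "0 < y c'" using c'(1) by (simp add: D_def)
          moreover have "t' \<in> tile F y c'" using TD[OF c'(1)] c'(2) by simp
          ultimately show "t + c \<noteq> t' + c'" using tiles_disjoint[OF c _ that] c' False by blast
        qed
        then have "restrict_config (shift c z) (tile F y c) = restrict_config (shift c x) (tile F y c)"
          by (simp add: restrict_config_eq_iff shift_def)
        moreover have "\<dots> \<in> S" using adm c by (simp add: admits_def)
        ultimately show ?thesis using False c by (simp add: D_def)
      qed
    qed
    then have "\<phi> z \<in> ?U'" using z(1) y by (auto simp: thinned_def)
    moreover have "card (D \<inter> ?Q) \<le> m"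
    proof -
      have "card (D \<inter> ?Q) * card F \<le> 2 * card (F + ?Q)"
        using fQ by (intro card_centres_le) (auto simp: D_def)
      then have "card (D \<inter> ?Q) * card F \<le> m * card F" using m by linarith
      then show ?thesis using cF by simp
    qed
    ultimately have "good u (x, D, \<phi> z)" using x xD z(4) by (auto simp: good_def)
    then show ?thesis by blast
  qed
  then obtain w where w: "\<And>u. u \<in> ?U \<Longrightarrow> good u (w u)" by metis
  define key where "key u = (restrict_config (snd (snd (w u))) E, fst (snd (w u)) \<inter> ?Q)" for u
  have key: "key ` ?U \<subseteq> ((\<lambda>u. restrict_config u E) ` ?U') \<times> {D. D \<subseteq> ?Q \<and> card D \<le> m}"
    using w by (force simp: key_def good_def split: prod.splits)
  have fin: "finite (((\<lambda>u. restrict_config u E) ` ?U') \<times> {D. D \<subseteq> ?Q \<and> card D \<le> m})"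
    using finite_alphabet.finite_block_image[OF alphabet_thinned E] fQ by auto
  have "block_count E ?U \<le> card (key ` ?U)"
    unfolding block_count_def
  proof (rule card_image_le_of_determined)
    show "finite (key ` ?U)" using key fin by (rule finite_subset)
  next
    fix u1 u2 assume u: "u1 \<in> ?U" "u2 \<in> ?U" "key u1 = key u2"
    obtain x1 D1 u1' where w1: "w u1 = (x1, D1, u1')" by (cases "w u1")
    obtain x2 D2 u2' where w2: "w u2 = (x2, D2, u2')" by (cases "w u2")
    have g1: "good u1 (x1, D1, u1')" and g2: "good u2 (x2, D2, u2')"
      using w[OF u(1)] w[OF u(2)] by (simp_all add: w1 w2)
    have eq: "\<forall>e\<in>E. u1' e = u2' e" and DQ: "D1 \<inter> ?Q = D2 \<inter> ?Q"
      using u(3) by (simp_all add: key_def w1 w2 restrict_config_eq_iff)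
    show "restrict_config u1 E = restrict_config u2 E"
      unfolding restrict_config_eq_iff
    proof
      fix g assume g: "g \<in> E"
      let ?near = "\<lambda>c. \<forall>m\<in>M. \<exists>t\<in>T. m + g = t + c"
      have inQ: "c \<in> ?Q" if near: "?near c" for c
      proof -
        obtain t where "t \<in> T" "0 + g = t + c" using near window(2) by blast
        then have "c = - t + g" "t \<in> F" using p(4) by (auto simp: add.assoc[symmetric])
        then show ?thesis using g by blast
      qed
      show "u1 g = u2 g"
      proof (cases "\<exists>c. c \<in> D1 \<inter> D2 \<and> ?near c")
        case True
        then obtain c where c: "c \<in> D1" "c \<in> D2" "?near c" by blast
        have "x1 (m + g) = x2 (m + g)" if m: "m \<in> M" for m
        proof -
          obtain t where "t \<in> T" "m + g = t + c" using c(3) m by blast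
          then have "Some (x1 (m + g)) = p t" "Some (x2 (m + g)) = p t"
            using g1 g2 c by (auto simp: good_def)
          then show ?thesis by (metis option.inject)
        qed
        then have "\<phi> x1 g = \<phi> x2 g" using g1 g2 by (intro block_code_at) (auto simp: good_def)
        then show ?thesis using g1 g2 by (simp add: good_def)
      next
        case False
        then have "\<not> (\<exists>c\<in>D1. ?near c)" "\<not> (\<exists>c\<in>D2. ?near c)" using inQ DQ by blast+
        then have "u1 g = u1' g" "u2 g = u2' g" using g1 g2 unfolding good_def by blast+
        then show ?thesis using eq g by simp
      qed
    qed
  qed
  also have "\<dots> \<le> card (((\<lambda>u. restrict_config u E) ` ?U') \<times> {D. D \<subseteq> ?Q \<and> card D \<le> m})"
    using fin key by (rule card_mono)
  finally show ?thesis by (simp add: card_cartesian_product block_count_def)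
qed

text \<open>
  The symbols of \<open>u\<close> on the ring are counted trivially.  On the core, \<open>u\<close> is the image of the pattern
  of \<open>x\<close> on the tile; that pattern either comes from \<open>V\<close> or is determined by its ring.
\<close>

lemma block_count_tile:
  assumes T: "finite T" and N: "\<And>m. m \<in> M \<Longrightarrow> m \<in> N"
    and V: "finite_alphabet V A"
    and Z: "\<And>u. u \<in> Z \<Longrightarrow> \<exists>x\<in>X. u = \<phi> x \<and> restrict_config (shift c x) T \<in> S"
    and reduced: "\<And>p p'. \<lbrakk>p \<in> S; p' \<in> S; dom p = T; dom p' = T; \<forall>t \<in> T - core N T. p t = p' t\<rbrakk>
       \<Longrightarrow> p = p' \<or> p \<in> {restrict_config v T |v. v \<in> X \<and> \<phi> v \<in> V}"
  shows "block_count ((\<lambda>t. t + c) ` T) Z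
    \<le> card A ^ card (T - core N T) * (card B ^ card (T - core N T) + block_count (core N T) V)"
proof -
  let ?tr = "\<lambda>T. (\<lambda>t. t + c) ` T" and ?I = "core N T" and ?R = "T - core N T"
  let ?SV = "{restrict_config v T |v. v \<in> X \<and> \<phi> v \<in> V}"
  have fI: "finite ?I" and fR: "finite ?R" using T core_subset finite_subset by blast+
  have "Z \<subseteq> \<phi> ` X" using Z by blast
  then have ZA: "finite_alphabet Z A" by (rule finite_alphabet_subset[OF alphabet_image])
  obtain w where w: "\<And>u. u \<in> Z \<Longrightarrow> w u \<in> X \<and> u = \<phi> (w u) \<and> restrict_config (shift c (w u)) T \<in> S"
    using Z by metis
  let ?p = "\<lambda>u. restrict_config (shift c (w u)) T"
  define Z2 where "Z2 = {u\<in>Z. ?p u \<in> ?SV}"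
  define Z1 where "Z1 = Z - Z2"
  have win: "m + i \<in> T" if "m \<in> M" "i \<in> ?I" for m i using that N by (auto simp: core_def)
  have "block_count (?tr ?I) Z = card ((\<lambda>u. restrict_config u (?tr ?I)) ` Z1 \<union> (\<lambda>u. restrict_config u (?tr ?I)) ` Z2)"
    unfolding block_count_def image_Un[symmetric] by (rule arg_cong[where f = card]) (auto simp: Z1_def Z2_def)
  also have "\<dots> \<le> card ((\<lambda>u. restrict_config u (?tr ?I)) ` Z1) + card ((\<lambda>u. restrict_config u (?tr ?I)) ` Z2)"
    by (rule card_Un_le)
  also have "\<dots> \<le> card B ^ card ?R + block_count ?I V"
  proof (rule add_mono)
    define Y where "Y = (\<lambda>u. shift c (w u)) ` Z1"
    have "Y \<subseteq> X" using w shift_invariantD[OF invariant_X] by (auto simp: Y_def Z1_def)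
    then have Y: "finite_alphabet Y B" by (rule finite_alphabet_subset[OF alphabet_X])
    have "card ((\<lambda>u. restrict_config u (?tr ?I)) ` Z1) \<le> card ((\<lambda>u. restrict_config (shift c (w u)) ?R) ` Z1)"
    proof (rule card_image_le_of_determined)
      show "finite ((\<lambda>u. restrict_config (shift c (w u)) ?R) ` Z1)"
        using finite_alphabet.finite_block_image[OF Y fR] by (simp add: Y_def image_image)
    next
      fix u1 u2 assume u: "u1 \<in> Z1" "u2 \<in> Z1"
        and eq: "restrict_config (shift c (w u1)) ?R = restrict_config (shift c (w u2)) ?R"
      have uZ: "u1 \<in> Z" "u2 \<in> Z" "?p u1 \<notin> ?SV" using u by (auto simp: Z1_def Z2_def)
      have "\<forall>t\<in>?R. ?p u1 t = ?p u2 t"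
        using eq by (simp add: restrict_config_eq_iff restrict_config_apply)
      then have "?p u1 = ?p u2"
        using reduced[of "?p u1" "?p u2"] w uZ by auto
      then have same: "w u1 (t + c) = w u2 (t + c)" if "t \<in> T" for t
        using that by (simp add: restrict_config_eq_iff shift_def)
      have "u1 (i + c) = u2 (i + c)" if "i \<in> ?I" for i
      proof -
        have "\<phi> (w u1) (i + c) = \<phi> (w u2) (i + c)"
          using same win that w uZ by (intro block_code_at) (auto simp: add.assoc[symmetric])
        then show ?thesis using w uZ by metis
      qed
      then show "restrict_config u1 (?tr ?I) = restrict_config u2 (?tr ?I)"
        by (auto simp: restrict_config_eq_iff)
    qed
    also have "\<dots> = block_count ?R Y" by (simp add: block_count_def Y_def image_image)
    also have "\<dots> \<le> card B ^ card ?R" by (rule finite_alphabet.block_count_le_alphabet_power[OF Y fR])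
    finally show "card ((\<lambda>u. restrict_config u (?tr ?I)) ` Z1) \<le> card B ^ card ?R" .
  next
    have sub: "(\<lambda>u. restrict_config (shift c u) ?I) ` Z2 \<subseteq> (\<lambda>u. restrict_config u ?I) ` V"
    proof safe
      fix u assume u: "u \<in> Z2"
      then have uZ: "u \<in> Z" by (simp add: Z2_def)
      obtain v where v: "v \<in> X" "\<phi> v \<in> V" "?p u = restrict_config v T"
        using u by (auto simp: Z2_def)
      have same: "w u (t + c) = v t" if "t \<in> T" for t
        using v(3) that by (simp add: restrict_config_eq_iff shift_def)
      have "shift c u i = \<phi> v i" if "i \<in> ?I" for i
      proof -
        have "\<phi> (w u) (i + c) = \<phi> v i"
          using same win that w uZ v by (intro block_code_at) (auto simp: add.assoc[symmetric])
        then show ?thesis using w[OF uZ] by (simp add: shift_def)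
      qed
      then have "restrict_config (shift c u) ?I = restrict_config (\<phi> v) ?I"
        by (simp add: restrict_config_eq_iff)
      then show "restrict_config (shift c u) ?I \<in> (\<lambda>u. restrict_config u ?I) ` V" using v(2) by simp
    qed
    have fV: "finite ((\<lambda>u. restrict_config u ?I) ` V)" by (rule finite_alphabet.finite_block_image[OF V fI])
    have "card ((\<lambda>u. restrict_config u (?tr ?I)) ` Z2) \<le> card ((\<lambda>u. restrict_config (shift c u) ?I) ` Z2)"
      using finite_subset[OF sub fV]
      by (rule card_image_le_of_determined) (simp add: restrict_config_eq_iff shift_def)
    also have "\<dots> \<le> block_count ?I V" unfolding block_count_def using fV sub by (rule card_mono)
    finally show "card ((\<lambda>u. restrict_config u (?tr ?I)) ` Z2) \<le> block_count ?I V" .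
  qed
  finally have core: "block_count (?tr ?I) Z \<le> card B ^ card ?R + block_count ?I V" .
  have "?tr T = ?tr ?R \<union> ?tr ?I" using core_subset by (auto simp: core_def)
  then have "block_count (?tr T) Z \<le> block_count (?tr ?R) Z * block_count (?tr ?I) Z"
    using finite_alphabet.block_count_Un[OF ZA, of "?tr ?R" "?tr ?I"] fR fI by simp
  also have "block_count (?tr ?R) Z \<le> card A ^ card (?tr ?R)"
    using finite_alphabet.block_count_le_alphabet_power[OF ZA, of "?tr ?R"] fR by simp
  also have "card (?tr ?R) = card ?R" by (intro card_image) (simp add: inj_on_def)
  finally show ?thesis using core by (meson mult_le_mono order_refl order_trans)
qed

end

section \<open>Counting the blocks of a thinned shift\<close>

context coded_shift
begin

lemma invariant_image: "shift_invariant (\<phi> ` X)"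
  unfolding shift_invariant_def using equivariant shift_invariantD[OF invariant_X] by (metis image_iff)

text \<open>
  For points with the same tiles near \<open>E\<close>, the blocks on \<open>E\<close> are counted separately outside the
  tiles and on every tile.  Outside, Shearer's inequality with the set \<open>K\<close> gains the cores of all tiles,
  since a translate of \<open>K\<close> that meets the complement of the tiles does not start in a core.  On a tile \<open>T\<close>,
  \<open>V\<close> allows at most \<open>exp (v * card T)\<close> blocks on the core.
\<close>

lemma block_count_fixed_tiling:
  fixes \<alpha> v r :: real
  assumes y: "tile_layer F L y" and E: "finite E" and Z: "Z \<subseteq> \<phi> ` X" "Z \<noteq> {}"
    and N: "M \<subseteq> N" "K \<subseteq> N" "uminus ` K \<subseteq> N"
    and K: "finite K" "0 \<in> K"
    and V: "shift_invariant V" "finite_alphabet V A"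
    and \<alpha>: "ln (real (block_count K (\<phi> ` X))) \<le> \<alpha> * card K"
    and v: "ln (real (block_count K V)) \<le> v * card K" "0 \<le> v" "v \<le> \<alpha>"
    and reduced: "\<And>p p' T. \<lbrakk>p \<in> S; p' \<in> S; dom p = T; dom p' = T; \<forall>t \<in> T - core N T. p t = p' t\<rbrakk>
       \<Longrightarrow> p = p' \<or> p \<in> {restrict_config v T |v. v \<in> X \<and> \<phi> v \<in> V}"
    and pats: "\<And>u c. u \<in> Z \<Longrightarrow> c \<in> tile_layer.inner_centres F y E \<Longrightarrow>
       \<exists>x\<in>X. u = \<phi> x \<and> restrict_config (shift c x) (tile F y c) \<in> S"
    and m: "card (tile_layer.inner_centres F y E) \<le> m"
    and cover: "real (card E) \<le> 4 * (\<Sum>c\<in>tile_layer.inner_centres F y E. real (card (tile F y c)))"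
    and rings: "(\<Sum>c\<in>tile_layer.inner_centres F y E. real (card (tile F y c - core N (tile F y c)))) \<le> r"
  shows "real (block_count E Z) \<le> exp (\<alpha> * card (uminus ` K + E) - (\<alpha> - v) * card E / 4
           + r * (\<alpha> + ln (card A) + ln (card B)) + m * ln 2)"
proof -
  interpret tile_layer F L y by fact
  let ?C = "inner_centres E"
  define T where "T c = tile F y c" for c
  define I where "I c = core N (T c)" for c
  define R where "R c = T c - I c" for c
  define W where "W = (\<Union>c\<in>?C. (\<lambda>t. t + c) ` T c)"
  define a b where "a = real (card A)" and "b = real (card B)"
  have ZA: "finite_alphabet Z A" by (rule finite_alphabet_subset[OF alphabet_image Z(1)])
  have fC: "finite ?C" using finite_inner_centres E by blast
  have fT: "finite (T c)" for c unfolding T_def by (rule finite_tile)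
  have fI: "finite (I c)" for c unfolding I_def by (rule finite_subset[OF core_subset fT])
  have fR: "finite (R c)" for c unfolding R_def using fT by simp
  have fW: "finite W" unfolding W_def using fC fT by simp
  have fKE: "finite (uminus ` K + E)" using K E by (simp add: finite_set_plus)
  have WE: "W \<subseteq> E" using tile_subset by (force simp: W_def T_def inner_centres_def)
  obtain u where u: "u \<in> \<phi> ` X" using Z by blast
  then obtain x where x: "x \<in> X" by blast
  have fA: "finite A" and fB: "finite B" using alphabet_image alphabet_X by (simp_all add: finite_alphabet_def)
  have "u 0 \<in> A" using alphabet_image u by (auto simp: finite_alphabet_def)
  moreover have "x 0 \<in> B" using alphabet_X x by (auto simp: finite_alphabet_def)
  ultimately have a1: "a \<ge> 1" and b1: "b \<ge> 1"
    using fA fB by (auto simp: a_def b_def Suc_le_eq card_gt_0_iff)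
  have card_TRI: "real (card (T c)) = card (R c) + real (card (I c))" for c
  proof -
    have "T c = R c \<union> I c" "R c \<inter> I c = {}" using core_subset by (auto simp: R_def I_def core_def)
    then show ?thesis using card_Un_disjoint[OF fR fI, of c c] by simp
  qed
  \<comment> \<open>A translate of \<open>K\<close> by a point of a core stays in the tile, so it does not meet \<open>E - W\<close>.\<close>
  have outside: "real (block_count (E - W) Z) \<le> exp (\<alpha> * (card (uminus ` K + E) - (\<Sum>c\<in>?C. real (card (I c)))))"
  proof -
    define J where "J = (\<Union>c\<in>?C. (\<lambda>t. t + c) ` I c)"
    have cJ: "card J = (\<Sum>c\<in>?C. card (I c))"
      unfolding J_def using fC core_subset
      by (intro card_disjoint_translates) (auto simp: inner_centres_def I_def T_def)
    have fJ: "finite J" unfolding J_def using fC fI by simp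
    have fO: "finite (uminus ` K + (E - W))" using K E by (simp add: finite_set_plus)
    have disj: "(uminus ` K + (E - W)) \<inter> J = {}"
    proof (rule ccontr)
      assume "(uminus ` K + (E - W)) \<inter> J \<noteq> {}"
      then obtain k e c t where h: "k \<in> K" "e \<in> E - W" "c \<in> ?C" "t \<in> I c" "- k + e = t + c"
        unfolding J_def set_plus_def by fastforce
      then have "e = (k + t) + c" by (simp add: minus_plus_eq_iff add.assoc)
      moreover have "k + t \<in> T c" using h N by (auto simp: I_def core_def)
      ultimately show False using h by (auto simp: W_def)
    qed
    have "(uminus ` K + (E - W)) \<union> J \<subseteq> uminus ` K + E"
    proof -
      have "I c \<subseteq> T c" for c using core_subset by (simp add: I_def)
      then have "J \<subseteq> W" unfolding J_def W_def by blast
      then have "J \<subseteq> E" using WE by blast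
      moreover have "E \<subseteq> uminus ` K + E"
      proof
        fix e assume "e \<in> E"
        moreover have "0 \<in> uminus ` K" using K(2) by force
        ultimately have "0 + e \<in> uminus ` K + E" by blast
        then show "e \<in> uminus ` K + E" by simp
      qed
      ultimately show ?thesis by (auto simp: set_plus_def)
    qed
    then have "card (uminus ` K + (E - W)) + card J \<le> card (uminus ` K + E)"
      using card_mono[OF fKE] card_Un_disjoint[OF fO fJ disj] by metis
    then have le: "real (card (uminus ` K + (E - W))) \<le> card (uminus ` K + E) - (\<Sum>c\<in>?C. real (card (I c)))"
      unfolding cJ using of_nat_mono[where 'a = real] by fastforce
    have "block_count (E - W) Z \<le> block_count (E - W) (\<phi> ` X)"
      using E Z by (intro finite_alphabet.block_count_mono_set[OF alphabet_image]) auto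
    then have "real (block_count (E - W) Z) \<le> real (block_count (E - W) (\<phi> ` X))" by simp
    also have "\<dots> \<le> exp (\<alpha> * card (uminus ` K + (E - W)))"
      using K E by (intro block_count_le_exp[OF invariant_image alphabet_image _ _ _ \<alpha>]) auto
    also have "\<dots> \<le> exp (\<alpha> * (card (uminus ` K + E) - (\<Sum>c\<in>?C. real (card (I c)))))"
      using le v by (simp add: mult_left_mono)
    finally show ?thesis .
  qed
  have inside: "real (block_count ((\<lambda>t. t + c) ` T c) Z) \<le> exp (card (R c) * (ln a + ln b) + ln 2 + v * card (T c))"
    if c: "c \<in> ?C" for c
  proof -
    have sub: "uminus ` K + I c \<subseteq> T c" using N(3) by (auto simp: set_plus_def I_def core_def)
    have "real (block_count (I c) V) \<le> exp (v * card (uminus ` K + I c))"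
      using K fI by (intro block_count_le_exp[OF V _ _ _ v(1)]) auto
    also have "\<dots> \<le> exp (v * card (T c))"
      using card_mono[OF fT sub] v by (simp add: mult_left_mono)
    finally have Vc: "real (block_count (I c) V) \<le> exp (v * card (T c))" .
    have "block_count ((\<lambda>t. t + c) ` T c) Z \<le> card A ^ card (R c) * (card B ^ card (R c) + block_count (I c) V)"
      unfolding R_def I_def
    proof (rule block_count_tile[OF fT _ V(2)])
      show "m \<in> N" if "m \<in> M" for m using that N(1) by blast
      show "\<exists>x\<in>X. u = \<phi> x \<and> restrict_config (shift c x) (T c) \<in> S" if "u \<in> Z" for u
        unfolding T_def using pats[OF that c] .
    qed (rule reduced)
    then have "real (block_count ((\<lambda>t. t + c) ` T c) Z) \<le> real (card A ^ card (R c) * (card B ^ card (R c) + block_count (I c) V))"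
      by (rule of_nat_mono)
    also have "\<dots> = a ^ card (R c) * (b ^ card (R c) + real (block_count (I c) V))"
      by (simp add: a_def b_def)
    also have "\<dots> \<le> a ^ card (R c) * (2 * (b ^ card (R c) * exp (v * card (T c))))"
    proof (intro mult_left_mono)
      have "1 \<le> b ^ card (R c)" "1 \<le> exp (v * card (T c))" using b1 v by auto
      then have "b ^ card (R c) \<le> b ^ card (R c) * exp (v * card (T c))"
        "exp (v * card (T c)) \<le> b ^ card (R c) * exp (v * card (T c))" by simp_all
      then show "b ^ card (R c) + real (block_count (I c) V) \<le> 2 * (b ^ card (R c) * exp (v * card (T c)))"
        using Vc by linarith
    qed (use a1 in simp)
    also have "\<dots> = exp (card (R c) * (ln a + ln b) + ln 2 + v * card (T c))"
    proof -
      have "exp (card (R c) * ln a) = a ^ card (R c)" "exp (card (R c) * ln b) = b ^ card (R c)"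
        using a1 b1 by (simp_all add: exp_of_nat_mult)
      then show ?thesis by (simp add: exp_add distrib_left)
    qed
    finally show ?thesis .
  qed
  have "(E - W) \<union> W = E" using WE by blast
  then have "block_count E Z = block_count ((E - W) \<union> W) Z" by (simp only:)
  also have "\<dots> \<le> block_count (E - W) Z * block_count W Z"
    using E fW by (intro finite_alphabet.block_count_Un[OF ZA]) auto
  also have "\<dots> \<le> block_count (E - W) Z * (\<Prod>c\<in>?C. block_count ((\<lambda>t. t + c) ` T c) Z)"
    unfolding W_def using fT by (intro mult_left_mono block_count_UN_le[OF fC ZA]) auto
  finally have "block_count E Z \<le> block_count (E - W) Z * (\<Prod>c\<in>?C. block_count ((\<lambda>t. t + c) ` T c) Z)" .
  from of_nat_mono[where 'a = real, OF this]
  have "real (block_count E Z) \<le> real (block_count (E - W) Z) * (\<Prod>c\<in>?C. real (block_count ((\<lambda>t. t + c) ` T c) Z))"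
    by simp
  also have "\<dots> \<le> exp (\<alpha> * (card (uminus ` K + E) - (\<Sum>c\<in>?C. real (card (I c))))) *
      (\<Prod>c\<in>?C. exp (card (R c) * (ln a + ln b) + ln 2 + v * card (T c)))"
    using inside outside by (intro mult_mono prod_mono prod_nonneg) auto
  also have "\<dots> = exp (\<alpha> * (card (uminus ` K + E) - (\<Sum>c\<in>?C. real (card (I c)))) +
      (\<Sum>c\<in>?C. card (R c) * (ln a + ln b) + ln 2 + v * card (T c)))"
    using fC by (simp add: exp_add exp_sum)
  also have "\<dots> \<le> exp (\<alpha> * card (uminus ` K + E) - (\<alpha> - v) * card E / 4
           + r * (\<alpha> + ln a + ln b) + m * ln 2)"
  proof -
    define t where "t = (\<Sum>c\<in>?C. real (card (T c)))"
    define k where "k = (\<Sum>c\<in>?C. real (card (R c)))"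
    have i: "(\<Sum>c\<in>?C. real (card (I c))) = t - k"
      unfolding t_def k_def using card_TRI by (simp add: sum.distrib)
    have s: "(\<Sum>c\<in>?C. card (R c) * (ln a + ln b) + ln 2 + v * card (T c))
        = k * (ln a + ln b) + card ?C * ln 2 + v * t"
      unfolding t_def k_def by (simp add: sum.distrib sum_distrib_left sum_distrib_right)
    have "k \<le> r" using rings by (simp add: k_def R_def I_def T_def)
    then have 1: "k * (\<alpha> + ln a + ln b) \<le> r * (\<alpha> + ln a + ln b)"
      using v a1 b1 by (intro mult_right_mono add_nonneg_nonneg) auto
    have "real (card E) / 4 \<le> t" using cover by (simp add: t_def T_def)
    then have "(\<alpha> - v) * (real (card E) / 4) \<le> (\<alpha> - v) * t" using v by (intro mult_left_mono) auto
    then have 2: "(\<alpha> - v) * real (card E) / 4 \<le> (\<alpha> - v) * t" by simp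
    have 3: "card ?C * ln 2 \<le> m * ln (2::real)" using m by (intro mult_right_mono) auto
    have "\<alpha> * (card (uminus ` K + E) - (t - k)) + (k * (ln a + ln b) + card ?C * ln 2 + v * t)
      = \<alpha> * card (uminus ` K + E) - (\<alpha> - v) * t + k * (\<alpha> + ln a + ln b) + card ?C * ln 2"
      by (simp add: algebra_simps)
    with 1 2 3 show ?thesis unfolding i s exp_le_cancel_iff by linarith
  qed
  finally show ?thesis by (simp add: a_def b_def)
qed

text \<open>
  Sort the points according to the labelled centres near \<open>E\<close>, which determine all tiles of the
  copies of \<open>F\<close> inside \<open>E\<close>, and apply the bound for a fixed tiling to every class.
\<close>

lemma block_count_thinned:
  fixes \<alpha> v r :: real
  assumes F: "finite F" "F \<noteq> {}" and E: "finite E"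
    and N: "M \<subseteq> N" "K \<subseteq> N" "uminus ` K \<subseteq> N"
    and K: "finite K" "0 \<in> K"
    and V: "shift_invariant V" "finite_alphabet V A"
    and \<alpha>: "ln (real (block_count K (\<phi> ` X))) \<le> \<alpha> * card K"
    and v: "ln (real (block_count K V)) \<le> v * card K" "0 \<le> v" "v \<le> \<alpha>"
    and reduced: "\<And>p p' T. \<lbrakk>p \<in> S; p' \<in> S; dom p = T; dom p' = T; \<forall>t \<in> T - core N T. p t = p' t\<rbrakk>
       \<Longrightarrow> p = p' \<or> p \<in> {restrict_config v T |v. v \<in> X \<and> \<phi> v \<in> V}"
    and m: "2 * card (F + (uminus ` F + E)) \<le> m * card F"
    and cover: "\<And>y. tile_layer F L y \<Longrightarrow>
       real (card E) \<le> 4 * (\<Sum>c\<in>tile_layer.inner_centres F y E. real (card (tile F y c)))"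
    and rings: "\<And>y. tile_layer F L y \<Longrightarrow>
       (\<Sum>c\<in>tile_layer.inner_centres F y E. real (card (tile F y c - core N (tile F y c)))) \<le> r"
  shows "real (block_count E (thinned F L S))
    \<le> card {D. D \<subseteq> (uminus ` F + E) \<times> {1..L} \<and> card D \<le> m} *
       exp (\<alpha> * card (uminus ` K + E) - (\<alpha> - v) * card E / 4 + r * (\<alpha> + ln (card A) + ln (card B)) + m * ln 2)"
proof -
  let ?Q = "uminus ` F + E"
  let ?bound = "exp (\<alpha> * card (uminus ` K + E) - (\<alpha> - v) * card E / 4 + r * (\<alpha> + ln (card A) + ln (card B)) + m * ln 2)"
  have cF: "card F > 0" using F by (simp add: card_gt_0_iff)
  have fQ: "finite ?Q" using F E by (simp add: finite_set_plus)
  let ?U = "thinned F L S"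
  have "\<forall>u\<in>?U. \<exists>w. fst w \<in> X \<and> u = \<phi> (fst w) \<and> snd w \<in> tile_layers F L \<and> admits F (snd w) S (fst w)"
    by (auto simp: thinned_def)
  then obtain w where w: "\<And>u. u \<in> ?U \<Longrightarrow> fst (w u) \<in> X \<and> u = \<phi> (fst (w u)) \<and>
      snd (w u) \<in> tile_layers F L \<and> admits F (snd (w u)) S (fst (w u))"
    by metis
  define ys where "ys u = snd (w u)" for u
  have layer: "tile_layer F L (ys u)" if "u \<in> ?U" for u
    using F w[OF that] by unfold_locales (auto simp: ys_def)
  define info where "info u = {(c, l). c \<in> ?Q \<and> 0 < l \<and> l = ys u c}" for u
  let ?\<I> = "{D. D \<subseteq> ?Q \<times> {1..L} \<and> card D \<le> m}"
  have f\<I>: "finite ?\<I>" using fQ by simp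
  have info: "info u \<in> ?\<I>" if u: "u \<in> ?U" for u
  proof -
    interpret tile_layer F L "ys u" using layer[OF u] .
    let ?P = "{c\<in>?Q. 0 < ys u c}"
    have "info u = (\<lambda>c. (c, ys u c)) ` ?P" by (auto simp: info_def)
    then have "card (info u) \<le> card ?P" using card_image_le[of ?P "\<lambda>c. (c, ys u c)"] fQ by simp
    moreover have "card ?P * card F \<le> 2 * card (F + ?Q)"
      using fQ by (intro card_centres_le) auto
    then have "card ?P * card F \<le> m * card F" using m by linarith
    then have "card ?P \<le> m" using cF by simp
    moreover have "ys u c \<le> L" for c using tile_rule[of c] by (simp add: tile_rule_def)
    ultimately show ?thesis by (auto simp: info_def Suc_le_eq)
  qed
  have each: "real (block_count E {u\<in>?U. info u = \<tau>}) \<le> ?bound" for \<tau>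
  proof (cases "{u\<in>?U. info u = \<tau>} = {}")
    case True
    show ?thesis unfolding True by (simp add: block_count_def)
  next
    case False
    then obtain u0 where u0: "u0 \<in> ?U" "info u0 = \<tau>" by blast
    define y where "y = ys u0"
    interpret tile_layer F L y using layer[OF u0(1)] by (simp add: y_def)
    have agree: "ys u c = y c" if "u \<in> ?U" "info u = \<tau>" "c \<in> ?Q" for u c
    proof -
      have "(c, l) \<in> info u \<longleftrightarrow> (c, l) \<in> info u0" for l using that u0 by simp
      then have "0 < l \<and> l = ys u c \<longleftrightarrow> 0 < l \<and> l = y c" for l
        using that(3) by (simp add: info_def y_def)
      then show ?thesis by (metis not_gr_zero)
    qed
    have C: "card (inner_centres E) \<le> m"
    proof -
      have "card (inner_centres E) * card F \<le> 2 * card (F + ?Q)"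
        using fQ inner_centres_subset by (intro card_centres_le) (auto simp: inner_centres_def)
      then have "card (inner_centres E) * card F \<le> m * card F" using m by linarith
      then show ?thesis using cF by simp
    qed
    show ?thesis
    proof (rule block_count_fixed_tiling[OF _ E _ False N K V \<alpha> v reduced _ C])
      show "tile_layer F L y" by unfold_locales
      then show "real (card E) \<le> 4 * (\<Sum>c\<in>inner_centres E. real (card (tile F y c)))"
        "(\<Sum>c\<in>inner_centres E. real (card (tile F y c - core N (tile F y c)))) \<le> r"
        using cover rings by blast+
      show "{u\<in>?U. info u = \<tau>} \<subseteq> \<phi> ` X" using thinned_subset by blast
    next
      fix u c assume u: "u \<in> {u\<in>?U. info u = \<tau>}" and c: "c \<in> inner_centres E"
      have cQ: "c \<in> ?Q" using c inner_centres_subset by blast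
      have nbr: "- f' + f + c \<in> ?Q" if "f \<in> F" "f' \<in> F" for f f'
      proof -
        have "f + c \<in> E" using c that by (auto simp: inner_centres_def)
        then have "- f' + (f + c) \<in> ?Q" using that by blast
        then show ?thesis by (simp add: add.assoc)
      qed
      have "ys u c = y c" using agree u cQ by blast
      moreover have "ys u (- f' + f + c) = y (- f' + f + c)" if "f \<in> F" "f' \<in> F" for f f'
        using agree u nbr[OF that] by blast
      ultimately have same: "tile F (ys u) c = tile F y c" "0 < ys u c"
        using c by (auto simp: tile_def inner_centres_def)
      have wu: "fst (w u) \<in> X" "u = \<phi> (fst (w u))" "admits F (ys u) S (fst (w u))"
        using w[of u] u by (simp_all add: ys_def)
      then have "restrict_config (shift c (fst (w u))) (tile F y c) \<in> S"
        using same by (metis admits_def)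
      then show "\<exists>x\<in>X. u = \<phi> x \<and> restrict_config (shift c x) (tile F y c) \<in> S"
        using wu by blast
    qed
  qed
  have "(\<lambda>u. restrict_config u E) ` ?U = (\<Union>\<tau>\<in>?\<I>. (\<lambda>u. restrict_config u E) ` {u\<in>?U. info u = \<tau>})"
    using info by blast
  then have "block_count E ?U \<le> (\<Sum>\<tau>\<in>?\<I>. block_count E {u\<in>?U. info u = \<tau>})"
    unfolding block_count_def using card_UN_le[OF f\<I>] by simp
  from of_nat_mono[where 'a = real, OF this]
  have "real (block_count E ?U) \<le> (\<Sum>\<tau>\<in>?\<I>. real (block_count E {u\<in>?U. info u = \<tau>}))" by simp
  also have "\<dots> \<le> (\<Sum>\<tau>\<in>?\<I>. ?bound)" using each by (rule sum_mono)
  also have "\<dots> = card ?\<I> * ?bound" by simp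
  finally show ?thesis .
qed

end

section \<open>Local rules, block codes and soficity\<close>

lemma topspace_full_shift: "topspace (full_shift A) = {x. range x \<subseteq> A}"
  by (auto simp: full_shift_def PiE_def extensional_def)

lemma compact_full_shift: "finite A \<Longrightarrow> compact_space (full_shift A)"
  unfolding full_shift_def by (simp add: compact_space_product_topology compact_space_discrete_topology)

lemma Hausdorff_full_shift: "Hausdorff_space (full_shift A)"
  unfolding full_shift_def by (simp add: Hausdorff_space_product_topology)

lemma subshift_alphabet: "subshift A X \<Longrightarrow> finite_alphabet X A"
  unfolding subshift_def finite_alphabet_def
  using closedin_subset[of "full_shift A" X] by (auto simp: topspace_full_shift)

lemma subshift_invariant: "subshift A X \<Longrightarrow> shift_invariant X"
  by (simp add: subshift_def shift_invariant_def)

lemma openin_cylinder: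
  assumes "finite S"
  shows "openin (full_shift A) {x. range x \<subseteq> A \<and> (\<forall>s\<in>S. x s = z s)}"
proof -
  have "{x. range x \<subseteq> A \<and> (\<forall>s\<in>S. x s = z s)} = PiE UNIV (\<lambda>s. if s \<in> S then {z s} \<inter> A else A)"
    by (auto simp: PiE_def extensional_def Pi_def split: if_splits)
  moreover have "finite {s. (if s \<in> S then {z s} \<inter> A else A) \<noteq> A}"
    using assms by (rule rev_finite_subset) auto
  ultimately show ?thesis
    unfolding full_shift_def by (auto simp: openin_PiE_gen)
qed

text \<open>
  A basic open set of the product topology restricts finitely many coordinates only.
\<close>

lemma openin_contains_cylinder:
  assumes "openin (full_shift A) U" "x \<in> U"
  obtains S where "finite S" "{x'. range x' \<subseteq> A \<and> (\<forall>s\<in>S. x' s = x s)} \<subseteq> U"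
proof -
  obtain Q where Q: "finite {i. Q i \<noteq> A}" "x \<in> PiE UNIV Q" "PiE UNIV Q \<subseteq> U"
    using assms unfolding full_shift_def openin_product_topology_alt by fastforce
  have "{x'. range x' \<subseteq> A \<and> (\<forall>s\<in>{i. Q i \<noteq> A}. x' s = x s)} \<subseteq> PiE UNIV Q"
  proof
    fix x' assume x': "x' \<in> {x'. range x' \<subseteq> A \<and> (\<forall>s\<in>{i. Q i \<noteq> A}. x' s = x s)}"
    have "x' i \<in> Q i" for i
      using x' Q(2) by (cases "Q i = A") (auto simp: PiE_iff)
    then show "x' \<in> PiE UNIV Q" by auto
  qed
  then show ?thesis using that[OF Q(1)] Q(3) by (meson subset_trans)
qed

text \<open>
  Forbid the patterns on \<open>D\<close> of those configurations that violate the rule at the identity.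
\<close>

lemma sft_local_rule:
  fixes B :: "'b set" and D :: "'g::group_add set"
  assumes "finite B" "finite D"
    and local: "\<And>z z'. \<lbrakk>\<forall>d\<in>D. z d = z' d; Q z\<rbrakk> \<Longrightarrow> Q z'"
  shows "sft B {z. range z \<subseteq> B \<and> (\<forall>g. Q (shift g z))}"
proof -
  define P where "P = {restrict_config z D |z. range z \<subseteq> B \<and> \<not> Q z}"
  have pats: "dom p \<subseteq> D \<and> ran p \<subseteq> B" if "p \<in> P" for p
  proof -
    obtain z where "p = restrict_config z D" "range z \<subseteq> B" using \<open>p \<in> P\<close> by (auto simp: P_def)
    then show ?thesis by (simp add: ran_restrict_config) blast
  qed
  then have fP: "finite P"
    by (intro finite_subset[OF _ finite_partial_maps[OF assms(2,1)]]) auto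
  have pP: "\<forall>p\<in>P. pattern B p"
    using finite_subset[OF _ assms(2)] pats by (simp add: pattern_def)
  have iff: "(\<forall>p\<in>P. \<not> occurs_in p z) \<longleftrightarrow> (\<forall>g. Q (shift g z))" if z: "range z \<subseteq> B" for z
  proof (intro iffI allI ballI)
    fix g assume no: "\<forall>p\<in>P. \<not> occurs_in p z"
    show "Q (shift g z)"
    proof (rule ccontr)
      assume "\<not> Q (shift g z)"
      moreover have "range (shift g z) \<subseteq> B" using z by (auto simp: shift_def)
      ultimately have "restrict_config (shift g z) D \<in> P" by (auto simp: P_def)
      moreover have "occurs_in (restrict_config (shift g z) D) z" by (auto simp: occurs_in_def)
      ultimately show False using no by blast
    qed
  next
    fix p assume all: "\<forall>g. Q (shift g z)" and "p \<in> P"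
    then obtain z0 where z0: "p = restrict_config z0 D" "\<not> Q z0" by (auto simp: P_def)
    show "\<not> occurs_in p z"
    proof
      assume "occurs_in p z"
      then obtain g where "restrict_config (shift g z) D = restrict_config z0 D"
        using z0 by (auto simp: occurs_in_def)
      then have "\<forall>d\<in>D. shift g z d = z0 d" by (simp add: restrict_config_eq_iff)
      then show False using local all z0(2) by blast
    qed
  qed
  have "{z. range z \<subseteq> B \<and> (\<forall>g. Q (shift g z))} = {x \<in> topspace (full_shift B). \<forall>p\<in>P. \<not> occurs_in p x}"
    using iff by (auto simp: topspace_full_shift)
  then show ?thesis
    unfolding sft_def using assms(1) fP pP by blast
qed

lemma sft_gluing:
  fixes X :: "('g::group_add \<Rightarrow> 'b) set"
  assumes "sft B X"
  obtains M where "finite M" "\<And>z. (\<And>g. \<exists>x\<in>X. \<forall>m\<in>M. z (m + g) = x (m + g)) \<Longrightarrow> z \<in> X"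
    "\<And>x. x \<in> X \<Longrightarrow> range x \<subseteq> B"
proof -
  obtain P where P: "finite P" "\<forall>p\<in>P. pattern B p"
    and X: "X = {x \<in> topspace (full_shift B). \<forall>p\<in>P. \<not> occurs_in p x}"
    using assms by (auto simp: sft_def)
  define M where "M = insert 0 (\<Union>p\<in>P. dom p)"
  have "finite M" using P by (auto simp: M_def pattern_def)
  moreover have "z \<in> X" if glue: "\<And>g. \<exists>x\<in>X. \<forall>m\<in>M. z (m + g) = x (m + g)" for z
  proof -
    have "z g \<in> B" for g
    proof -
      obtain x where "x \<in> X" "z (0 + g) = x (0 + g)" using glue[of g] by (auto simp: M_def)
      then show ?thesis by (auto simp: X topspace_full_shift)
    qed
    moreover have "\<not> occurs_in p z" if p: "p \<in> P" for p
    proof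
      assume "occurs_in p z"
      then obtain g where g: "restrict_config (shift g z) (dom p) = p" by (auto simp: occurs_in_def)
      obtain x where x: "x \<in> X" "\<forall>m\<in>M. z (m + g) = x (m + g)" using glue[of g] by blast
      then have "\<forall>m\<in>dom p. shift g z m = shift g x m" using p unfolding M_def shift_def by blast
      then have "restrict_config (shift g x) (dom p) = p"
        using g restrict_config_eq_iff[of "shift g z" "dom p" "shift g x"] by simp
      then show False using x(1) p by (auto simp: X occurs_in_def)
    qed
    ultimately show ?thesis by (auto simp: X topspace_full_shift)
  qed
  moreover have "range x \<subseteq> B" if "x \<in> X" for x using that by (simp add: X topspace_full_shift)
  ultimately show ?thesis using that by blast
qed

lemma sft_closed:
  fixes X :: "('g::group_add \<Rightarrow> 'b) set"
  assumes "sft B X"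
  shows "closedin (full_shift B) X"
proof -
  obtain M where M: "finite M" "\<And>z. (\<And>g. \<exists>x\<in>X. \<forall>m\<in>M. z (m + g) = x (m + g)) \<Longrightarrow> z \<in> X"
    "\<And>x. x \<in> X \<Longrightarrow> range x \<subseteq> B"
    using sft_gluing[OF assms] by blast
  have "openin (full_shift B) (topspace (full_shift B) - X)"
  proof (subst openin_subopen, rule ballI)
    fix z assume z: "z \<in> topspace (full_shift B) - X"
    then obtain g where g: "\<And>x. x \<in> X \<Longrightarrow> \<exists>m\<in>M. z (m + g) \<noteq> x (m + g)" using M(2)[of z] by blast
    let ?C = "{x. range x \<subseteq> B \<and> (\<forall>s\<in>(\<lambda>m. m + g) ` M. x s = z s)}"
    have "openin (full_shift B) ?C" using M(1) by (intro openin_cylinder) simp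
    moreover have "z \<in> ?C" using z by (simp add: topspace_full_shift)
    moreover have "?C \<subseteq> topspace (full_shift B) - X" using g by (fastforce simp: topspace_full_shift)
    ultimately show "\<exists>T. openin (full_shift B) T \<and> z \<in> T \<and> T \<subseteq> topspace (full_shift B) - X" by blast
  qed
  moreover have "X \<subseteq> topspace (full_shift B)" using M(3) by (auto simp: topspace_full_shift)
  ultimately show ?thesis by (simp add: closedin_def)
qed

lemma sft_shift_invariant:
  fixes X :: "('g::group_add \<Rightarrow> 'b) set"
  assumes "sft B X"
  shows "shift_invariant X"
proof -
  obtain P where X: "X = {x \<in> topspace (full_shift B). \<forall>p\<in>P. \<not> occurs_in p x}"
    using assms by (auto simp: sft_def)
  have "occurs_in p x" if "occurs_in p (shift g x)" for p g and x :: "'g \<Rightarrow> 'b"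
    using that by (auto simp: occurs_in_def shift_shift)
  then show ?thesis
    by (fastforce simp: shift_invariant_def X topspace_full_shift shift_def[abs_def])
qed

text \<open>
  The Curtis-Hedlund-Lyndon theorem: around every point there is a cylinder on which the image
  symbol at \<open>h\<close> is constant, and finitely many of these cylinders cover the compact set \<open>X\<close>.
\<close>

lemma continuous_factor_is_block_code:
  assumes "finite B" "closedin (full_shift B) X"
    and cont: "continuous_map (subtopology (full_shift B) X) (full_shift A) \<phi>"
  obtains M where "finite M" "\<And>x x'. \<lbrakk>x \<in> X; x' \<in> X; \<forall>m\<in>M. x m = x' m\<rbrakk> \<Longrightarrow> \<phi> x h = \<phi> x' h"
proof -
  let ?C = "\<lambda>x S. {x'. range x' \<subseteq> B \<and> (\<forall>s\<in>S. x' s = x s)}"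
  have XB: "range x \<subseteq> B" if "x \<in> X" for x
    using closedin_subset[OF assms(2)] that by (auto simp: topspace_full_shift)
  have "\<exists>S. finite S \<and> (\<forall>x'\<in>X. (\<forall>s\<in>S. x' s = x s) \<longrightarrow> \<phi> x' h = \<phi> x h)" if x: "x \<in> X" for x
  proof -
    have tX: "topspace (subtopology (full_shift B) X) = X"
      using XB by (auto simp: topspace_full_shift)
    let ?O = "{w. range w \<subseteq> A \<and> (\<forall>s\<in>{h}. w s = \<phi> x s)}"
    have "openin (subtopology (full_shift B) X) {x'\<in>X. \<phi> x' \<in> ?O}"
      using openin_continuous_map_preimage[OF cont openin_cylinder[of "{h}" A "\<phi> x"]] by (simp only: tX finite.intros)
    then obtain U where U: "openin (full_shift B) U" "{x'\<in>X. \<phi> x' \<in> ?O} = U \<inter> X"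
      by (auto simp: openin_subtopology)
    have "\<phi> x \<in> topspace (full_shift A)"
      using cont x tX unfolding continuous_map_def by blast
    then have "x \<in> U" using U(2) x by (auto simp: topspace_full_shift)
    then obtain S where S: "finite S" "?C x S \<subseteq> U"
      using openin_contains_cylinder[OF U(1)] by blast
    have "\<phi> x' h = \<phi> x h" if "x' \<in> X" "\<forall>s\<in>S. x' s = x s" for x'
    proof -
      have "x' \<in> U \<inter> X" using that S XB by blast
      then show ?thesis using U(2) by blast
    qed
    then show ?thesis using S(1) by blast
  qed
  then obtain S where S: "\<And>x. x \<in> X \<Longrightarrow> finite (S x) \<and> (\<forall>x'\<in>X. (\<forall>s\<in>S x. x' s = x s) \<longrightarrow> \<phi> x' h = \<phi> x h)"
    by metis
  have "compactin (full_shift B) X"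
    using closedin_compact_space[OF compact_full_shift[OF assms(1)] assms(2)] .
  moreover have "openin (full_shift B) U" if U: "U \<in> (\<lambda>x. ?C x (S x)) ` X" for U
  proof -
    obtain x where "x \<in> X" "U = ?C x (S x)" using U by blast
    then show ?thesis using S openin_cylinder[of "S x" B x] by blast
  qed
  moreover have "X \<subseteq> \<Union> ((\<lambda>x. ?C x (S x)) ` X)"
    using XB by blast
  ultimately have "\<exists>\<U>. finite \<U> \<and> \<U> \<subseteq> (\<lambda>x. ?C x (S x)) ` X \<and> X \<subseteq> \<Union>\<U>"
    by (rule compactinD)
  then obtain \<U> where \<U>: "finite \<U>" "\<U> \<subseteq> (\<lambda>x. ?C x (S x)) ` X" "X \<subseteq> \<Union>\<U>"
    by blast
  obtain X0 where X0: "X0 \<subseteq> X" "finite X0" "\<U> = (\<lambda>x. ?C x (S x)) ` X0"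
    using finite_subset_image[OF \<U>(1,2)] by blast
  show ?thesis
  proof (rule that)
    show "finite (\<Union>x\<in>X0. S x)" using X0 S by blast
    fix x x' assume x: "x \<in> X" "x' \<in> X" "\<forall>m\<in>(\<Union>x\<in>X0. S x). x m = x' m"
    then obtain x0 where x0: "x0 \<in> X0" "x \<in> ?C x0 (S x0)" using \<U>(3) X0(3) by blast
    then have "\<forall>s\<in>S x0. x s = x0 s" "\<forall>s\<in>S x0. x' s = x0 s" using x(3) by auto
    moreover have "x0 \<in> X" using x0 X0 by blast
    ultimately have "\<phi> x h = \<phi> x0 h" "\<phi> x' h = \<phi> x0 h" using S x(1,2) by blast+
    then show "\<phi> x h = \<phi> x' h" by simp
  qed
qed

lemma sofic_has_block_code:
  fixes W :: "('g::group_add \<Rightarrow> 'a) set"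
  assumes "sofic A W"
  obtains B :: "nat set" and X \<phi> M where "coded_shift X B A \<phi> M" "\<phi> ` X = W"
    "continuous_map (subtopology (full_shift B) X) (full_shift A) \<phi>"
proof -
  obtain B :: "nat set" and X \<phi> where W: "subshift A W" and X: "sft B X" and fm: "factor_map B X A W \<phi>"
    using assms by (auto simp: sofic_def)
  have cont: "continuous_map (subtopology (full_shift B) X) (full_shift A) \<phi>"
    using fm by (auto simp: factor_map_def dest: continuous_map_into_fulltopology)
  have im: "\<phi> ` X = W" and eq: "\<And>x g. x \<in> X \<Longrightarrow> \<phi> (shift g x) = shift g (\<phi> x)"
    using fm by (auto simp: factor_map_def)
  have fB: "finite B" using X by (simp add: sft_def)
  obtain M1 where M1: "finite M1" "\<And>z. (\<And>g. \<exists>x\<in>X. \<forall>m\<in>M1. z (m + g) = x (m + g)) \<Longrightarrow> z \<in> X"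
    "\<And>x. x \<in> X \<Longrightarrow> range x \<subseteq> B"
    using sft_gluing[OF X] by blast
  obtain M2 where M2: "finite M2" "\<And>x x'. \<lbrakk>x \<in> X; x' \<in> X; \<forall>m\<in>M2. x m = x' m\<rbrakk> \<Longrightarrow> \<phi> x 0 = \<phi> x' 0"
    using continuous_factor_is_block_code[OF fB sft_closed[OF X] cont] by blast
  have "coded_shift X B A \<phi> (insert 0 (M1 \<union> M2))"
  proof (rule coded_shift.intro)
    show "finite_alphabet X B" using fB M1(3) by unfold_locales
    show "finite_alphabet (\<phi> ` X) A" unfolding im by (rule subshift_alphabet[OF W])
    show "shift_invariant X" by (rule sft_shift_invariant[OF X])
    show "z \<in> X" if "\<And>g. \<exists>x\<in>X. \<forall>m\<in>insert 0 (M1 \<union> M2). z (m + g) = x (m + g)" for z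
      using that by (intro M1(2)) blast
    show "finite (insert 0 (M1 \<union> M2))" "0 \<in> insert 0 (M1 \<union> M2)" using M1(1) M2(1) by simp_all
    show "\<phi> x 0 = \<phi> x' 0" if "x \<in> X" "x' \<in> X" "\<forall>m\<in>insert 0 (M1 \<union> M2). x m = x' m" for x x'
      using that(3) by (intro M2(2)[OF that(1,2)]) simp
    show "\<phi> (shift g x) = shift g (\<phi> x)" if "x \<in> X" for x g
      by (rule eq[OF that])
  qed
  then show ?thesis using that im cont by blast
qed

context coded_shift
begin

text \<open>
  A point of \<open>X\<close> and a tile layer are coded into one configuration over a finite set of natural
  numbers.  Membership in \<open>X\<close>, the rules of the layer and the condition on the tile patterns are all
  visible in a finite window, so the codes form a shift of finite type, and \<open>\<phi>\<close> after decoding is a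
  factor map onto the thinned shift, which is closed as a compact image.
\<close>

lemma sofic_thinned:
  fixes e :: "'b \<Rightarrow> nat"
  assumes e: "inj_on e B" and F: "finite F" "F \<noteq> {}"
    and cont: "continuous_map (subtopology (full_shift B) X) (full_shift A) \<phi>"
  shows "sofic A (thinned F L S)"
proof -
  have fB: "finite B" and XB: "\<And>x. x \<in> X \<Longrightarrow> range x \<subseteq> B"
    using alphabet_X by (auto simp: finite_alphabet_def)
  define B' where "B' = (\<lambda>(b, l). prod_encode (e b, l)) ` (B \<times> {..L})"
  define dx where "dx z = (\<lambda>g. the_inv_into B e (fst (prod_decode (z g))))" for z :: "'g \<Rightarrow> nat"
  define dy where "dy z = (\<lambda>g. snd (prod_decode (z g)))" for z :: "'g \<Rightarrow> nat"
  define Q where "Q z \<longleftrightarrow> (\<exists>x\<in>X. \<forall>m\<in>M. dx z m = x m) \<and> tile_rule F L (dy z) 0 \<and>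
     (0 < dy z 0 \<longrightarrow> restrict_config (dx z) (tile F (dy z) 0) \<in> S)" for z
  define X' where "X' = {z. range z \<subseteq> B' \<and> (\<forall>g. Q (shift g z))}"
  have dx_shift: "dx (shift g z) = shift g (dx z)" and dy_shift: "dy (shift g z) = shift g (dy z)" for g z
    by (simp_all add: dx_def dy_def shift_def)
  have fB': "finite B'" using fB by (simp add: B'_def)
  have sft: "sft B' X'"
    unfolding X'_def
  proof (rule sft_local_rule[OF fB'])
    let ?D = "insert 0 (M \<union> F \<union> (uminus ` F + F))"
    show "finite ?D" using window F by (simp add: finite_set_plus)
    fix z z' :: "'g \<Rightarrow> nat" assume agree: "\<forall>d\<in>?D. z d = z' d" and Q: "Q z"
    have M: "dx z m = dx z' m" if "m \<in> M" for m using agree that by (simp add: dx_def)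
    have xF: "dx z f = dx z' f" if "f \<in> F" for f using agree that by (simp add: dx_def)
    have y0: "dy z 0 = dy z' 0" using agree by (simp add: dy_def)
    have yF: "dy z (- f' + f) = dy z' (- f' + f)" if "f \<in> F" "f' \<in> F" for f f'
    proof -
      have "- f' + f \<in> uminus ` F + F" using that by blast
      then show ?thesis using agree by (simp add: dy_def)
    qed
    have tile: "tile F (dy z) 0 = tile F (dy z') 0" using y0 yF by (auto simp: tile_def)
    have cov: "{f \<in> F. f + 0 \<in> covered F (dy z)} = {f \<in> F. f + 0 \<in> covered F (dy z')}"
      using yF by (auto simp: covered_def)
    have "tile_rule F L (dy z') 0"
      using Q y0 yF unfolding Q_def tile_rule_def tile cov by simp
    moreover have "restrict_config (dx z) (tile F (dy z') 0) = restrict_config (dx z') (tile F (dy z') 0)"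
      using xF tile_subset[of F "dy z'" 0] by (auto simp: restrict_config_eq_iff)
    ultimately show "Q z'"
      using Q M y0 tile unfolding Q_def by simp
  qed
  have char: "(\<forall>g. Q (shift g z)) \<longleftrightarrow> dx z \<in> X \<and> dy z \<in> tile_layers F L \<and> admits F (dy z) S (dx z)" for z
  proof -
    have "(\<forall>g. \<exists>x\<in>X. \<forall>m\<in>M. dx z (m + g) = x m) \<longleftrightarrow> dx z \<in> X"
    proof
      assume all: "\<forall>g. \<exists>x\<in>X. \<forall>m\<in>M. dx z (m + g) = x m"
      show "dx z \<in> X"
      proof (rule gluing)
        fix g
        obtain x where x: "x \<in> X" "\<forall>m\<in>M. dx z (m + g) = x m" using all by blast
        then have "\<forall>m\<in>M. dx z (m + g) = shift (- g) x (m + g)" by (simp add: shift_def add.assoc)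
        then show "\<exists>x\<in>X. \<forall>m\<in>M. dx z (m + g) = x (m + g)"
          using shift_invariantD[OF invariant_X x(1)] by blast
      qed
    next
      assume "dx z \<in> X"
      then have "shift g (dx z) \<in> X" for g by (rule shift_invariantD[OF invariant_X])
      moreover have "\<forall>m\<in>M. dx z (m + g) = shift g (dx z) m" for g by (simp add: shift_def)
      ultimately show "\<forall>g. \<exists>x\<in>X. \<forall>m\<in>M. dx z (m + g) = x m" by blast
    qed
    then show ?thesis
      unfolding Q_def dx_shift dy_shift tile_shift tile_rule_shift all_conj_distrib tile_layers_def admits_def
      by (simp add: shift_def[of _ "dx z"] shift_def[of _ "dy z"])
  qed
  have dxB: "dx z g \<in> B" if "range z \<subseteq> B'" for z and g :: 'g
  proof -
    have "z g \<in> B'" using that by blast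
    then show ?thesis using e by (auto simp: B'_def dx_def the_inv_into_f_f)
  qed
  have cont_dx: "continuous_map (full_shift B') (full_shift B) dx"
    unfolding full_shift_def continuous_map_componentwise_UNIV
  proof
    fix g :: 'g
    have "continuous_map (discrete_topology B') (discrete_topology B) (\<lambda>b. the_inv_into B e (fst (prod_decode b)))"
      using e by (auto simp: B'_def the_inv_into_f_f)
    then have "continuous_map (product_topology (\<lambda>_. discrete_topology B') UNIV) (discrete_topology B)
        ((\<lambda>b. the_inv_into B e (fst (prod_decode b))) \<circ> (\<lambda>z. z g))"
      by (intro continuous_map_compose[OF continuous_map_product_projection]) auto
    then show "continuous_map (product_topology (\<lambda>_. discrete_topology B') UNIV) (discrete_topology B) (\<lambda>z. dx z g)"
      by (simp add: dx_def o_def)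
  qed
  have X'X: "dx ` X' \<subseteq> X" using char by (auto simp: X'_def)
  have im: "(\<phi> \<circ> dx) ` X' = thinned F L S"
  proof
    show "(\<phi> \<circ> dx) ` X' \<subseteq> thinned F L S" using char by (auto simp: X'_def thinned_def)
    show "thinned F L S \<subseteq> (\<phi> \<circ> dx) ` X'"
    proof
      fix u assume "u \<in> thinned F L S"
      then obtain x y where x: "x \<in> X" "u = \<phi> x" and y: "y \<in> tile_layers F L" "admits F y S x"
        by (auto simp: thinned_def)
      define z where "z g = prod_encode (e (x g), y g)" for g
      have xB: "x g \<in> B" for g using XB[OF x(1)] by blast
      have "y g \<le> L" for g using y(1) by (auto simp: tile_layers_def tile_rule_def)
      then have "range z \<subseteq> B'" using xB by (force simp: z_def B'_def)
      moreover have "dx z = x" "dy z = y" using xB e by (auto simp: dx_def dy_def z_def the_inv_into_f_f)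
      ultimately have "z \<in> X'" "u = (\<phi> \<circ> dx) z" using x y char[of z] by (auto simp: X'_def)
      then show "u \<in> (\<phi> \<circ> dx) ` X'" by blast
    qed
  qed
  have "continuous_map (subtopology (full_shift B') X') (subtopology (full_shift B) X) dx"
    using X'X cont_dx by (auto simp: continuous_map_in_subtopology intro: continuous_map_from_subtopology)
  then have cont': "continuous_map (subtopology (full_shift B') X') (full_shift A) (\<phi> \<circ> dx)"
    using cont by (rule continuous_map_compose)
  have "compactin (full_shift B') X'"
    using closedin_compact_space[OF compact_full_shift[OF fB'] sft_closed[OF sft]] .
  then have "compactin (subtopology (full_shift B') X') X'"
    by (simp add: compactin_subtopology)
  then have "compactin (full_shift A) (thinned F L S)"
    using image_compactin[OF _ cont'] im by metis
  then have closed: "closedin (full_shift A) (thinned F L S)"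
    by (rule compactin_imp_closedin[OF Hausdorff_full_shift])
  have equiv: "(\<phi> \<circ> dx) (shift g z) = shift g ((\<phi> \<circ> dx) z)" if "z \<in> X'" for z g
    using that X'X by (auto simp: dx_shift equivariant)
  have X'_inv: "shift_invariant X'" by (rule sft_shift_invariant[OF sft])
  have "subshift A (thinned F L S)"
    unfolding subshift_def
  proof (intro conjI ballI allI)
    show "finite A" using alphabet_image by (simp add: finite_alphabet_def)
    fix u g assume "u \<in> thinned F L S"
    then obtain z where "z \<in> X'" "u = (\<phi> \<circ> dx) z" using im by blast
    then have "shift g z \<in> X'" "shift g u = (\<phi> \<circ> dx) (shift g z)"
      using X'_inv equiv by (auto dest: shift_invariantD)
    then show "shift g u \<in> thinned F L S" using im by blast
  qed (rule closed)
  moreover have "factor_map B' X' A (thinned F L S) (\<phi> \<circ> dx)"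
    unfolding factor_map_def
    using im equiv cont' by (auto simp: continuous_map_in_subtopology)
  ultimately show ?thesis unfolding sofic_def using sft by blast
qed

end

section \<open>Entropy estimates for thinned shifts\<close>

lemma ln_le_of_le_exp: "0 < x \<Longrightarrow> x \<le> exp y \<Longrightarrow> ln x \<le> (y :: real)"
  by (metis ln_exp ln_le_cancel_iff exp_gt_zero)

text \<open>
  Here \<open>f\<close> stands for the size of \<open>F\<close> and \<open>e\<close> for the size of \<open>E\<close>: there are about \<open>e\<close> positions
  with up to \<open>f ^ 2\<close> labels each, and of the order of \<open>e / f\<close> centres.  The weight \<open>s = 1 / f ^ 3\<close>
  makes the labels cancel and leaves a cost of order \<open>ln f / f\<close> per point of \<open>E\<close>.
\<close>

lemma card_sparse_subsets_le:
  fixes f e m :: nat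
  assumes "f \<ge> 1" "finite R" "real m \<le> 5 * e / f" "card R \<le> 2 * e * f ^ 2"
  shows "real (card {D. D \<subseteq> R \<and> card D \<le> m}) \<le> exp ((15 * ln f + 2) / f * e)"
proof -
  define s where "s = 1 / real f ^ 3"
  have s: "0 < s" "s \<le> 1" using assms(1) by (auto simp: s_def)
  have "real m * ln (1 / s) = real m * (3 * ln f)"
    using assms(1) by (simp add: s_def ln_realpow)
  also have "\<dots> \<le> (5 * e / f) * (3 * ln f)"
    using assms by (intro mult_right_mono) auto
  finally have 1: "real m * ln (1 / s) \<le> (5 * e / f) * (3 * ln f)" .
  have "s * card R \<le> s * (2 * e * f ^ 2)"
    using s of_nat_mono[where 'a = real, OF assms(4)] by (intro mult_left_mono) auto
  also have "\<dots> = 2 * e / f"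
    using assms(1) by (simp add: s_def power2_eq_square power3_eq_cube field_simps)
  finally have "real m * ln (1 / s) + s * card R \<le> (5 * e / f) * (3 * ln f) + 2 * e / f"
    using 1 by linarith
  also have "\<dots> = (15 * ln f + 2) / f * e"
    using assms(1) by (simp add: field_simps)
  finally have "exp (real m * ln (1 / s) + s * card R) \<le> exp ((15 * ln f + 2) / f * e)" by simp
  then show ?thesis using card_small_subsets_le[OF assms(2) s, of m] by linarith
qed

lemma eventually_large_invariant:
  fixes F :: "'g::group_add set" and \<delta> :: real
  assumes Fs: "folner_sequence Fs" "infinite (UNIV :: 'g set)"
    and fin: "finite F" "finite N" "finite K" "F \<noteq> {}" and \<delta>: "\<delta> > 0"
  shows "\<forall>\<^sub>F n in sequentially. finite (Fs n) \<and> Fs n \<noteq> {} \<and>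
    almost_invariant (F \<union> uminus ` F) (1 / (16 * real (card F))) (Fs n) \<and>
    card (F + (uminus ` F + Fs n)) \<le> 2 * card (Fs n) \<and>
    card (F + (uminus ` F + (N + Fs n))) \<le> 2 * card (Fs n) \<and>
    card (uminus ` F + Fs n) \<le> 2 * card (Fs n) \<and>
    real (card (uminus ` K + Fs n)) \<le> (1 + \<delta>) * card (Fs n) \<and> card F \<le> card (Fs n)"
proof -
  have cF: "card F > 0" using fin by (simp add: card_gt_0_iff)
  have double: "\<forall>\<^sub>F n in sequentially. card (H + Fs n) \<le> 2 * card (Fs n)" if "finite H" for H
    using almost_invariant_folner[OF Fs(1) that, of 1, simplified]
  proof eventually_elim
    case (elim n)
    from almost_invariant_card_plus[OF this that] show ?case by simp
  qed
  have "finite (F + uminus ` F)" "finite (F + uminus ` F + N)" using fin by (auto simp: finite_set_plus)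
  note d = this[THEN double] double[of "uminus ` F"]
  have "\<forall>\<^sub>F n in sequentially. almost_invariant (F \<union> uminus ` F) (1 / (16 * real (card F))) (Fs n)"
    using fin cF by (intro almost_invariant_folner[OF Fs(1)]) auto
  moreover have "\<forall>\<^sub>F n in sequentially. almost_invariant (uminus ` K) \<delta> (Fs n)"
    using fin \<delta> by (intro almost_invariant_folner[OF Fs(1)]) auto
  moreover have "\<forall>\<^sub>F n in sequentially. card (uminus ` F + Fs n) \<le> 2 * card (Fs n)"
    using fin by (intro double) simp
  ultimately show ?thesis
    using d(1,2) card_folner_unbounded[OF Fs, of "card F"]
  proof eventually_elim
    case (elim n)
    have "real (card (uminus ` K + Fs n)) \<le> (1 + \<delta>) * card (Fs n)"
      using almost_invariant_card_plus[OF elim(2)] fin by simp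
    then show ?case using elim by (simp add: almost_invariant_def add.assoc)
  qed
qed

text \<open>
  The integer \<open>m\<close> bounds the number of centres near a set of size \<open>e\<close>; rounding up is paid for by \<open>f \<le> e\<close>.
\<close>

lemma centre_bound_exists:
  fixes f e :: nat
  assumes "f \<ge> 1" "f \<le> e"
  obtains m :: nat where "4 * e \<le> m * f" "real m \<le> 5 * e / f"
proof (rule that)
  show "4 * e \<le> (4 * e div f + 1) * f"
    using dividend_less_div_times[of f "4 * e"] assms(1) by (simp add: algebra_simps)
  have "real (4 * e div f + 1) \<le> 4 * e / f + 1"
    using of_nat_div_le_of_nat[of "4 * e" f, where 'a = real] by simp
  also have "\<dots> \<le> 5 * e / f" using assms by (simp add: field_simps)
  finally show "real (4 * e div f + 1) \<le> 5 * e / f" .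
qed

context coded_shift
begin

lemma invariant_thinned: "shift_invariant (thinned F L S)"
  unfolding shift_invariant_def thinned_def
proof (intro ballI allI)
  fix u g assume "u \<in> \<phi> ` {x\<in>X. \<exists>y\<in>tile_layers F L. admits F y S x}"
  then obtain x y where x: "x \<in> X" "u = \<phi> x" and y: "y \<in> tile_layers F L" "admits F y S x" by blast
  have "shift g y \<in> tile_layers F L" using y(1) unfolding tile_layers_def mem_Collect_eq tile_rule_shift by blast
  moreover have "admits F (shift g y) S (shift g x)"
    using y(2) unfolding admits_def tile_shift shift_shift by (simp add: shift_def)
  moreover have "shift g x \<in> X" using x invariant_X by (simp add: shift_invariantD)
  moreover have "shift g u = \<phi> (shift g x)" using x equivariant by simp
  ultimately show "shift g u \<in> \<phi> ` {x\<in>X. \<exists>y\<in>tile_layers F L. admits F y S x}" by blast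
qed

text \<open>
  Pass to the limit along a Folner sequence in the counting of exchanged patterns.
\<close>

lemma entropy_drop_le:
  fixes Fs :: "nat \<Rightarrow> 'g set"
  assumes Fs: "folner_sequence Fs" "infinite (UNIV :: 'g set)"
    and F: "finite F" "F \<noteq> {}"
    and N: "finite N" "\<And>m m'. m \<in> M \<Longrightarrow> m' \<in> M \<Longrightarrow> m' - m \<in> N"
    and p: "p' \<in> S" "p' \<noteq> p" "dom p = T" "T \<subseteq> F"
    and q: "q \<in> X" "p' = restrict_config q T"
    and ring: "\<And>t. t \<in> T - core N T \<Longrightarrow> p t = p' t"
    and ne: "thinned F L S \<noteq> {}"
  shows "shift_entropy (thinned F L S)
    \<le> shift_entropy (thinned F L (S - {p})) + (15 * ln (card F) + 2) / card F"
proof -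
  let ?U = "thinned F L S" and ?U' = "thinned F L (S - {p})" and ?\<xi> = "(15 * ln (card F) + 2) / card F"
  have cF: "card F \<ge> 1" using F by (simp add: Suc_le_eq card_gt_0_iff)
  have "\<forall>\<^sub>F n in sequentially. block_rate (Fs n) ?U \<le> block_rate (Fs n) ?U' + ?\<xi>"
    using eventually_large_invariant[OF Fs F(1) N(1) N(1) F(2) zero_less_one]
  proof eventually_elim
    case (elim n)
    let ?E = "Fs n"
    have E: "finite ?E" "card ?E > 0" using elim by (auto simp: card_gt_0_iff)
    obtain m where m: "4 * card ?E \<le> m * card F" "real m \<le> 5 * card ?E / card F"
      using centre_bound_exists[OF cF, of "card ?E"] elim by blast
    let ?\<D> = "{D. D \<subseteq> uminus ` F + ?E \<and> card D \<le> m}"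
    have "2 * card (F + (uminus ` F + ?E)) \<le> m * card F" using elim m(1) by linarith
    from block_count_remove_pattern[OF F E(1) N(2) p q ring this]
    have le: "block_count ?E ?U \<le> block_count ?E ?U' * card ?\<D>" by simp
    have pos: "block_count ?E ?U > 0" by (rule finite_alphabet.block_count_pos[OF alphabet_thinned E(1) ne])
    then have pos': "block_count ?E ?U' > 0" "card ?\<D> > 0" using le by (auto intro!: gr0I)
    have "card (uminus ` F + ?E) \<le> 2 * card ?E" using elim by simp
    also have "\<dots> \<le> 2 * card ?E * card F ^ 2" using cF by simp
    finally have "real (card ?\<D>) \<le> exp (?\<xi> * card ?E)"
      using card_sparse_subsets_le[OF cF, of "uminus ` F + ?E" m "card ?E"] m(2) F E by (simp add: finite_set_plus)
    then have D: "ln (real (card ?\<D>)) \<le> ?\<xi> * card ?E"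
      using pos'(2) by (intro ln_le_of_le_exp) auto
    have "ln (real (block_count ?E ?U)) \<le> ln (real (block_count ?E ?U' * card ?\<D>))"
      using le pos pos' by (subst ln_le_cancel_iff) (auto simp del: of_nat_mult)
    also have "\<dots> = ln (real (block_count ?E ?U')) + ln (real (card ?\<D>))"
      using pos' by (simp add: ln_mult)
    finally have "ln (real (block_count ?E ?U)) \<le> ln (real (block_count ?E ?U')) + ?\<xi> * card ?E"
      using D by linarith
    then show ?case using E(2) by (simp add: block_rate_def divide_right_mono add_divide_distrib[symmetric] pos_divide_le_eq distrib_right)
  qed
  moreover have "(\<lambda>n. block_rate (Fs n) ?U) \<longlonglongrightarrow> shift_entropy ?U"
    "(\<lambda>n. block_rate (Fs n) ?U' + ?\<xi>) \<longlonglongrightarrow> shift_entropy ?U' + ?\<xi>"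
    using block_rate_tendsto_shift_entropy[OF invariant_thinned alphabet_thinned Fs(1)]
    by (auto intro: tendsto_add)
  ultimately show ?thesis by (intro tendsto_le[OF sequentially_bot])
qed

text \<open>
  The rate \<open>\<alpha>\<close> bounds the blocks outside the tiles, the rate \<open>v\<close> those inside.  As the tiles fill at least a
  quarter of \<open>E\<close>, the entropy falls short of \<open>\<alpha>\<close> by a quarter of \<open>\<alpha> - v\<close>, up to the
  costs of near-invariance of \<open>E\<close>, of the rings and of the centres.
\<close>

lemma entropy_thinned_le:
  fixes \<alpha> v :: real and Fs :: "nat \<Rightarrow> 'g set"
  assumes Fs: "folner_sequence Fs" "infinite (UNIV :: 'g set)"
    and F: "finite F" "F \<noteq> {}" "almost_invariant (N \<union> uminus ` N) \<epsilon> F" and L: "L \<le> card F ^ 2"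
    and N: "finite N" "M \<subseteq> N" "K \<subseteq> N" "uminus ` K \<subseteq> N"
    and K: "finite K" "0 \<in> K"
    and V: "shift_invariant V" "finite_alphabet V A"
    and \<alpha>: "ln (real (block_count K (\<phi> ` X))) \<le> \<alpha> * card K"
    and v: "ln (real (block_count K V)) \<le> v * card K" "0 \<le> v" "v \<le> \<alpha>"
    and reduced: "\<And>p p' T. \<lbrakk>p \<in> S; p' \<in> S; dom p = T; dom p' = T; \<forall>t \<in> T - core N T. p t = p' t\<rbrakk>
       \<Longrightarrow> p = p' \<or> p \<in> {restrict_config v T |v. v \<in> X \<and> \<phi> v \<in> V}"
    and ne: "thinned F L S \<noteq> {}" and \<tau>: "\<tau> > 0"
  shows "shift_entropy (thinned F L S) \<le> \<alpha> + \<tau> - (\<alpha> - v) / 4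
    + 8 * \<epsilon> * (\<alpha> + ln (card A) + ln (card B)) + (15 * ln (card F) + 7) / card F"
proof -
  let ?U = "thinned F L S" and ?\<xi> = "(15 * ln (card F) + 2) / card F"
  have cF: "card F \<ge> 1" using F by (simp add: Suc_le_eq card_gt_0_iff)
  have \<alpha>0: "\<alpha> \<ge> 0" using v by simp
  define \<delta> where "\<delta> = \<tau> / (\<alpha> + 1)"
  have \<delta>: "\<delta> > 0" "\<alpha> * \<delta> \<le> \<tau>" using \<tau> \<alpha>0 by (auto simp: \<delta>_def field_simps)
  obtain n where elim: "finite (Fs n) \<and> Fs n \<noteq> {} \<and>
    almost_invariant (F \<union> uminus ` F) (1 / (16 * real (card F))) (Fs n) \<and>
    card (F + (uminus ` F + Fs n)) \<le> 2 * card (Fs n) \<and>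
    card (F + (uminus ` F + (N + Fs n))) \<le> 2 * card (Fs n) \<and>
    card (uminus ` F + Fs n) \<le> 2 * card (Fs n) \<and>
    real (card (uminus ` K + Fs n)) \<le> (1 + \<delta>) * card (Fs n) \<and> card F \<le> card (Fs n)"
    using eventually_happens'[OF sequentially_bot eventually_large_invariant[OF Fs F(1) N(1) K(1) F(2) \<delta>(1)]]
    by blast
  define E where "E = Fs n"
  note elim = elim[folded E_def]
  have E: "finite E" "E \<noteq> {}" "card E > 0" using elim by (auto simp: card_gt_0_iff)
  obtain m where m: "4 * card E \<le> m * card F" "real m \<le> 5 * card E / card F"
    using centre_bound_exists[OF cF, of "card E"] elim by blast
  let ?\<D> = "{D. D \<subseteq> (uminus ` F + E) \<times> {1..L} \<and> card D \<le> m}"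
  let ?x = "\<alpha> * card (uminus ` K + E) - (\<alpha> - v) * card E / 4 + (8 * \<epsilon> * card E) * (\<alpha> + ln (card A) + ln (card B)) + m * ln 2"
  have m2: "2 * card (F + (uminus ` F + E)) \<le> m * card F" using elim m(1) by linarith
  have "real (block_count E ?U) \<le> card ?\<D> * exp ?x"
  proof (rule block_count_thinned[OF F(1,2) E(1) N(2,3,4) K V \<alpha> v reduced m2])
    fix y assume "tile_layer F L y"
    then interpret tile_layer F L y .
    show "real (card E) \<le> 4 * (\<Sum>c\<in>inner_centres E. real (card (tile F y c)))"
      using elim cF by (intro tiles_cover_quarter) auto
    show "(\<Sum>c\<in>inner_centres E. real (card (tile F y c - core N (tile F y c)))) \<le> 8 * \<epsilon> * card E"
      using elim by (intro tile_rings_small[OF N(1) F(3)]) auto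
  qed
  also have "\<dots> \<le> exp (?\<xi> * card E) * exp ?x"
  proof (rule mult_right_mono)
    have "card ((uminus ` F + E) \<times> {1..L}) \<le> (2 * card E) * card F ^ 2"
      unfolding card_cartesian_product using elim L by (intro mult_le_mono) auto
    then show "real (card ?\<D>) \<le> exp (?\<xi> * card E)"
      using E F m(2) by (intro card_sparse_subsets_le[OF cF]) (auto simp: finite_set_plus)
  qed simp
  also have "\<dots> = exp (?\<xi> * card E + ?x)" by (simp only: exp_add)
  finally have "real (block_count E ?U) \<le> exp (?\<xi> * card E + ?x)" .
  then have "ln (real (block_count E ?U)) \<le> ?\<xi> * card E + ?x"
    using finite_alphabet.block_count_pos[OF alphabet_thinned E(1) ne]
    by (intro ln_le_of_le_exp) auto
  also have "\<dots> \<le> (\<alpha> + \<tau> - (\<alpha> - v) / 4 + 8 * \<epsilon> * (\<alpha> + ln (card A) + ln (card B)) + (15 * ln (card F) + 7) / card F) * card E"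
  proof -
    have "\<alpha> * card (uminus ` K + E) \<le> \<alpha> * ((1 + \<delta>) * card E)"
      using elim \<alpha>0 by (intro mult_left_mono) auto
    also have "\<dots> = \<alpha> * card E + (\<alpha> * \<delta>) * card E" by (simp add: algebra_simps)
    also have "(\<alpha> * \<delta>) * card E \<le> \<tau> * card E" using \<delta> by (intro mult_right_mono) auto
    finally have 1: "\<alpha> * card (uminus ` K + E) \<le> \<alpha> * card E + \<tau> * card E" by simp
    have "real m * ln 2 \<le> real m * 1" using ln_2_less_1 by (intro mult_left_mono) auto
    then have 2: "real m * ln 2 \<le> 5 / card F * card E" using m(2) by simp
    have 3: "?\<xi> + 5 / card F = (15 * ln (card F) + 7) / card F" by (simp add: add_divide_distrib)
    have alg: "(a + t - (a - w) / 4 + 8 * e * l + (x + q)) * c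
        = x * c + ((a * c + t * c) - (a - w) * c / 4 + (8 * e * c) * l + q * c)" for a t w e l x q c :: real
      by (simp add: field_simps)
    show ?thesis unfolding 3[symmetric] alg using 1 2
      by (intro add_left_mono add_mono diff_right_mono order_refl)
  qed
  finally have "block_rate E ?U \<le> \<alpha> + \<tau> - (\<alpha> - v) / 4
    + 8 * \<epsilon> * (\<alpha> + ln (card A) + ln (card B)) + (15 * ln (card F) + 7) / card F"
    using E(3) by (simp add: block_rate_def pos_divide_le_eq)
  moreover have "amenable TYPE('g)" using Fs(1) by (auto simp: amenable_def)
  then have "shift_entropy ?U \<le> block_rate E ?U"
    by (intro shift_entropy_le_block_rate[OF invariant_thinned alphabet_thinned] E(1,2))
  ultimately show ?thesis by linarith
qed

end

section \<open>Density of sofic entropies\<close>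

lemma entropy_cost_small:
  assumes "c > 0"
  obtains n0 :: nat where "\<And>n. n \<ge> n0 \<Longrightarrow> (15 * ln (real n) + 7) / n \<le> c"
proof -
  have "(\<lambda>n. 15 * (ln (real n) / n) + 7 * (1 / real n)) \<longlonglongrightarrow> 15 * 0 + 7 * 0"
    by (intro tendsto_intros lim_ln_over_n lim_1_over_n)
  then have "(\<lambda>n. (15 * ln (real n) + 7) / n) \<longlonglongrightarrow> 0"
    by (simp add: add_divide_distrib)
  then have "\<forall>\<^sub>F n in sequentially. (15 * ln (real n) + 7) / n < c"
    using assms by (rule order_tendstoD)
  then show ?thesis
    using that unfolding eventually_sequentially by (meson less_imp_le)
qed

lemma sofic_subshift: "sofic A U \<Longrightarrow> subshift A U"
  by (simp add: sofic_def)

text \<open>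
  A smallest set \<open>S\<close> of patterns is taken among those that contain the patterns of \<open>V\<close> and keep the
  entropy of the thinned shift at least \<open>h\<close>.  Then no further pattern can be exchanged away, since the
  entropy would drop by less than the gap \<open>r\<close>; the resulting upper bound for the entropy contradicts
  the choice of \<open>b\<close>.
\<close>

lemma sofic_entropies_dense:
  fixes A :: "'a set" and V W :: "('g::group_add \<Rightarrow> 'a) set"
  assumes G: "countable (UNIV :: 'g set)" "infinite (UNIV :: 'g set)" "amenable TYPE('g)"
    and W: "sofic A W" and V: "subshift A V" and "V \<subseteq> W"
    and h: "shift_entropy V \<le> h" "h \<le> shift_entropy W" and r: "r > 0"
  shows "\<exists>U. V \<subseteq> U \<and> U \<subseteq> W \<and> sofic A U \<and> \<bar>shift_entropy U - h\<bar> < r"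
proof (rule ccontr)
  assume contra: "\<not> (\<exists>U. V \<subseteq> U \<and> U \<subseteq> W \<and> sofic A U \<and> \<bar>shift_entropy U - h\<bar> < r)"
  define between where "between U \<longleftrightarrow> V \<subseteq> U \<and> U \<subseteq> W \<and> sofic A U" for U
  have gap: "shift_entropy U \<ge> h + r" if "between U" "shift_entropy U > h - r" for U
    using contra that unfolding between_def by (metis abs_less_iff diff_less_eq less_diff_eq minus_diff_eq not_le add.commute)
  note Vf = subshift_invariant[OF V] subshift_alphabet[OF V]
  define hs where "hs = {shift_entropy U |U. between U \<and> h \<le> shift_entropy U}"
  define b where "b = Inf hs"
  have "between W" using W \<open>V \<subseteq> W\<close> by (simp add: between_def)
  then have hs_ne: "hs \<noteq> {}" using h(2) by (auto simp: hs_def)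
  have bdd: "bdd_below hs" by (rule bdd_belowI[of _ h]) (auto simp: hs_def)
  have b_le: "b \<le> shift_entropy U" if "between U" "h \<le> shift_entropy U" for U
    unfolding b_def using that bdd by (intro cInf_lower) (auto simp: hs_def)
  have "h + r \<le> b"
    unfolding b_def using hs_ne r gap by (intro cInf_greatest) (fastforce simp: hs_def)+
  then have br: "shift_entropy V + r \<le> b" using h(1) by simp
  define \<eta> where "\<eta> = r / 100"
  have \<eta>: "\<eta> > 0" using r by (simp add: \<eta>_def)
  have "\<exists>s\<in>hs. s < b + \<eta>" using cInf_less_iff[OF hs_ne bdd, of "b + \<eta>"] \<eta> by (simp add: b_def)
  then obtain U0 where U0: "between U0" "h \<le> shift_entropy U0" "shift_entropy U0 < b + \<eta>"
    by (auto simp: hs_def)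
  have sU0: "sofic A U0" "V \<subseteq> U0" "U0 \<subseteq> W" using U0 by (auto simp: between_def)
  obtain B :: "nat set" and X \<phi> M where coded: "coded_shift X B A \<phi> M" and im: "\<phi> ` X = U0"
    and cont: "continuous_map (subtopology (full_shift B) X) (full_shift A) \<phi>"
    by (rule sofic_has_block_code[OF sU0(1)])
  interpret coded_shift X B A \<phi> M by (rule coded)
  obtain Fs :: "nat \<Rightarrow> 'g set" where Fs: "folner_sequence Fs" using G(3) by (auto simp: amenable_def)
  define \<alpha> where "\<alpha> = b + \<eta>"
  \<comment> \<open>\<open>\<alpha>\<close> and \<open>v\<close> will bound the block rates of \<open>U0\<close> and \<open>V\<close> on a common set \<open>K\<close>; they differ by at
    least \<open>r\<close>, so the tiles gain \<open>r / 4\<close>, while each of the remaining error terms is at most \<open>r / 100\<close>.\<close>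
  define v where "v = shift_entropy V + \<eta>"
  have v0: "0 \<le> v" using shift_entropy_nonneg[OF Vf G(3)] \<eta> by (simp add: v_def)
  have v\<alpha>: "v \<le> \<alpha>" "r \<le> \<alpha> - v" using br r by (auto simp: v_def \<alpha>_def)
  have "\<forall>\<^sub>F n in sequentially. block_rate (Fs n) U0 < \<alpha>"
    using order_tendstoD(2)[OF block_rate_tendsto_shift_entropy[OF invariant_image alphabet_image Fs]] U0(3)
    by (simp add: im \<alpha>_def)
  moreover have "\<forall>\<^sub>F n in sequentially. block_rate (Fs n) V < v"
    using order_tendstoD(2)[OF block_rate_tendsto_shift_entropy[OF Vf Fs]] \<eta> by (simp add: v_def)
  moreover have "\<forall>\<^sub>F n in sequentially. 0 \<in> Fs n" using Fs by (simp add: folner_sequence_def)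
  ultimately have "\<forall>\<^sub>F n in sequentially. block_rate (Fs n) U0 < \<alpha> \<and> block_rate (Fs n) V < v \<and> 0 \<in> Fs n"
    by eventually_elim simp
  then obtain n where "block_rate (Fs n) U0 < \<alpha> \<and> block_rate (Fs n) V < v \<and> 0 \<in> Fs n"
    using eventually_happens'[OF sequentially_bot] by blast
  then obtain K where K: "finite K" "0 \<in> K" "block_rate K U0 < \<alpha>" "block_rate K V < v"
    using folner_sequence_finite[OF Fs] by blast
  have cK: "card K > 0" using K by (auto simp: card_gt_0_iff)
  have K\<alpha>: "ln (real (block_count K (\<phi> ` X))) \<le> \<alpha> * card K" and Kv: "ln (real (block_count K V)) \<le> v * card K"
    using K cK by (simp_all add: im block_rate_def pos_divide_less_eq)
  \<comment> \<open>Differences of window points serve the exchange, \<open>K\<close> and its inverse serve Shearer's inequality.\<close>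
  define N where "N = (\<lambda>(m', m). m' - m) ` (M \<times> M) \<union> K \<union> uminus ` K"
  have fN: "finite N" using window K by (simp add: N_def)
  have N_diff: "m' - m \<in> N" if "m \<in> M" "m' \<in> M" for m m' using that by (auto simp: N_def)
  have MN: "M \<subseteq> N" using N_diff[OF window(2)] by auto
  have KN: "K \<subseteq> N" "uminus ` K \<subseteq> N" by (auto simp: N_def)
  define \<Lambda> where "\<Lambda> = \<alpha> + ln (card A) + ln (card B)"
  define \<epsilon> where "\<epsilon> = r / (800 * (\<bar>\<Lambda>\<bar> + 1))"
  have \<epsilon>: "\<epsilon> > 0" using r by (simp add: \<epsilon>_def)
  have "8 * \<epsilon> * \<Lambda> \<le> 8 * \<epsilon> * (\<bar>\<Lambda>\<bar> + 1)" using \<epsilon> by (intro mult_left_mono) auto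
  also have "\<dots> = r / 100" by (simp add: \<epsilon>_def field_simps)
  finally have \<epsilon>\<Lambda>: "8 * \<epsilon> * \<Lambda> \<le> r / 100" .
  obtain n0 :: nat where n0: "\<And>n. n \<ge> n0 \<Longrightarrow> (15 * ln (real n) + 7) / n \<le> r / 100"
    using entropy_cost_small[of "r / 100"] r by auto
  have "\<forall>\<^sub>F n in sequentially. almost_invariant (N \<union> uminus ` N) \<epsilon> (Fs n)"
    using fN \<epsilon> by (intro almost_invariant_folner[OF Fs]) auto
  then have "\<forall>\<^sub>F n in sequentially. almost_invariant (N \<union> uminus ` N) \<epsilon> (Fs n) \<and> n0 \<le> card (Fs n)"
    using card_folner_unbounded[OF Fs G(2), of n0] by eventually_elim simp
  then obtain n where "almost_invariant (N \<union> uminus ` N) \<epsilon> (Fs n) \<and> n0 \<le> card (Fs n)"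
    using eventually_happens'[OF sequentially_bot] by blast
  then obtain F where F: "finite F" "F \<noteq> {}" "almost_invariant (N \<union> uminus ` N) \<epsilon> F"
    and cost: "(15 * ln (card F) + 7) / card F \<le> r / 100"
    using n0 by (auto simp: almost_invariant_def)
  have cF: "card F \<ge> 1" using F by (simp add: Suc_le_eq card_gt_0_iff)
  define L where "L = card F ^ 2"
  obtain y0 where y0: "y0 \<in> tile_layers F L"
    using tile_layers_nonempty[OF G(1) F(1,2)] by (auto simp: L_def)
  define P where "P = {restrict_config x T |x T. x \<in> X \<and> T \<subseteq> F}"
  define PV where "PV = {restrict_config x T |x T. x \<in> X \<and> \<phi> x \<in> V \<and> T \<subseteq> F}"
  have "P \<subseteq> {p. dom p \<subseteq> F \<and> ran p \<subseteq> B}"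
  proof
    fix p assume "p \<in> P"
    then obtain x T where x: "x \<in> X" "p = restrict_config x T" "T \<subseteq> F" unfolding P_def by blast
    have "range x \<subseteq> B" using alphabet_X x(1) by (simp add: finite_alphabet_def)
    then show "p \<in> {p. dom p \<subseteq> F \<and> ran p \<subseteq> B}" using x(3) by (simp add: x(2) ran_restrict_config) blast
  qed
  moreover have "finite {p :: 'g \<rightharpoonup> nat. dom p \<subseteq> F \<and> ran p \<subseteq> B}"
    using alphabet_X by (intro finite_partial_maps[OF F(1)]) (simp add: finite_alphabet_def)
  ultimately have fP: "finite P" by (rule finite_subset)
  have admP: "admits F y P x" if "x \<in> X" for x y
    using shift_invariantD[OF invariant_X that] tile_subset unfolding admits_def P_def by blast
  have fullP: "thinned F L P = U0" using admP y0 by (auto simp: thinned_def im[symmetric])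
  have thin: "between (thinned F L S)" if S: "PV \<subseteq> S" for S
    unfolding between_def
  proof (intro conjI)
    show "sofic A (thinned F L S)" by (rule sofic_thinned[OF inj_on_id F(1,2) cont])
    show "thinned F L S \<subseteq> W" using thinned_subset im sU0(3) by blast
    show "V \<subseteq> thinned F L S"
    proof
      fix u assume u: "u \<in> V"
      then obtain x where x: "x \<in> X" "u = \<phi> x" using sU0(2) im by blast
      have "\<phi> (shift c x) \<in> V" for c
        using shift_invariantD[OF Vf(1) u] equivariant[OF x(1)] x(2) by simp
      then have "restrict_config (shift c x) (tile F y0 c) \<in> PV" for c
        using shift_invariantD[OF invariant_X x(1)] tile_subset unfolding PV_def by blast
      then have "admits F y0 S x" using S by (auto simp: admits_def)
      then show "u \<in> thinned F L S" using x y0 by (auto simp: thinned_def)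
    qed
  qed
  let ?ok = "\<lambda>S. PV \<subseteq> S \<and> S \<subseteq> P \<and> h \<le> shift_entropy (thinned F L S)"
  have "PV \<subseteq> P" by (auto simp: P_def PV_def)
  then have "?ok P" using U0(2) by (simp add: fullP)
  then obtain S where S: "?ok S" "\<And>S'. ?ok S' \<Longrightarrow> card S \<le> card S'"
    using ex_has_least_nat[of ?ok P card] by blast
  have fS: "finite S" using S(1) fP finite_subset by blast
  have hS: "b \<le> shift_entropy (thinned F L S)" using b_le thin S(1) by blast
  have ne: "thinned F L S \<noteq> {}"
  proof
    assume "thinned F L S = {}"
    then have "shift_entropy (thinned F L S) = 0" by (simp add: shift_entropy_def)
    then show False using hS br r shift_entropy_nonneg[OF Vf G(3)] by linarith
  qed
  have reduced: "p = p' \<or> p \<in> {restrict_config v T |v. v \<in> X \<and> \<phi> v \<in> V}"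
    if p: "p \<in> S" "p' \<in> S" "dom p = T" "dom p' = T" "\<forall>t \<in> T - core N T. p t = p' t" for p p' T
  proof (rule ccontr)
    assume neg: "\<not> (p = p' \<or> p \<in> {restrict_config v T |v. v \<in> X \<and> \<phi> v \<in> V})"
    obtain q T' where q: "q \<in> X" "p' = restrict_config q T'" "T' \<subseteq> F" using p(2) S(1) by (auto simp: P_def)
    have T': "T' = T" using p(4) q(2) by (metis dom_restrict_config)
    have "p \<notin> PV"
    proof
      assume "p \<in> PV"
      then obtain x T'' where x: "x \<in> X" "\<phi> x \<in> V" "p = restrict_config x T''" by (auto simp: PV_def)
      then have "T'' = T" using p(3) by (metis dom_restrict_config)
      then show False using neg x by blast
    qed
    then have PV': "PV \<subseteq> S - {p}" using S(1) by blast
    have "card (S - {p}) < card S" using p(1) fS by (metis card_Diff1_less)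
    then have "\<not> ?ok (S - {p})" using S(2) by (metis not_le)
    then have "shift_entropy (thinned F L (S - {p})) < h" using PV' S(1) by auto
    then have low: "shift_entropy (thinned F L (S - {p})) \<le> h - r"
      using gap[OF thin[OF PV']] r by force
    have "shift_entropy (thinned F L S) \<le> shift_entropy (thinned F L (S - {p})) + (15 * ln (card F) + 2) / card F"
    proof (rule entropy_drop_le[OF Fs G(2) F(1,2) fN N_diff p(2) _ p(3) _ q(1) _ _ ne])
      show "p' \<noteq> p" using neg by blast
      show "T \<subseteq> F" "p' = restrict_config q T" using q T' by auto
      show "p t = p' t" if "t \<in> T - core N T" for t using p(5) that by blast
    qed
    also have "\<dots> \<le> (h - r) + (15 * ln (card F) + 7) / card F"
      using low cF by (intro add_mono divide_right_mono) auto
    finally show False using cost r S(1) by linarith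
  qed
  have "shift_entropy (thinned F L S) \<le> \<alpha> + r / 100 - (\<alpha> - v) / 4
    + 8 * \<epsilon> * (\<alpha> + ln (card A) + ln (card B)) + (15 * ln (card F) + 7) / card F"
    by (rule entropy_thinned_le[OF Fs G(2) F _ fN MN KN K(1,2) Vf K\<alpha> Kv v0 v\<alpha>(1) reduced ne])
      (use r in \<open>auto simp: L_def\<close>)
  moreover have "\<alpha> + r / 100 - (\<alpha> - v) / 4 + x + y < b" if "x \<le> r / 100" "y \<le> r / 100" for x y
  proof -
    have "\<alpha> = b + r / 100" "(\<alpha> - v) / 4 \<ge> r / 4" using v\<alpha>(2) by (simp_all add: \<alpha>_def \<eta>_def)
    then show ?thesis using that r by argo
  qed
  note this[OF \<epsilon>\<Lambda>[unfolded \<Lambda>_def] cost]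
  ultimately show False using hS by linarith
qed

theorem theorem5p2:
  fixes A :: "'a set" and V W :: "('g::group_add \<Rightarrow> 'a) set"
  assumes "countable (UNIV :: 'g set)"
    and "infinite (UNIV :: 'g set)"
    and "amenable TYPE('g)"
    and "sofic A W"
    and "subshift A V"
    and "V \<subseteq> W"
    and "shift_entropy V < shift_entropy W"
  shows "let S = {shift_entropy U |U. V \<subseteq> U \<and> U \<subseteq> W \<and> sofic A U};
             I = {shift_entropy V..shift_entropy W}
         in S \<subseteq> I \<and> I \<subseteq> closure S"
  unfolding Let_def
proof (intro conjI subsetI)
  fix s assume "s \<in> {shift_entropy U |U. V \<subseteq> U \<and> U \<subseteq> W \<and> sofic A U}"
  then obtain U where U: "s = shift_entropy U" "V \<subseteq> U" "U \<subseteq> W" "sofic A U" by blast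
  have sub: "subshift A U" "subshift A W" using U(4) assms(4) by (simp_all add: sofic_subshift)
  have "shift_entropy V \<le> s"
    unfolding U(1) using assms sub U by (intro shift_entropy_mono[of V U A] subshift_invariant[of A] subshift_alphabet)
  moreover have "s \<le> shift_entropy W"
    unfolding U(1) using assms sub U by (intro shift_entropy_mono[of U W A] subshift_invariant[of A] subshift_alphabet)
  ultimately show "s \<in> {shift_entropy V..shift_entropy W}" by simp
next
  fix h assume "h \<in> {shift_entropy V..shift_entropy W}"
  then have h: "shift_entropy V \<le> h" "h \<le> shift_entropy W" by auto
  show "h \<in> closure {shift_entropy U |U. V \<subseteq> U \<and> U \<subseteq> W \<and> sofic A U}"
    unfolding closure_approachable
  proof (intro allI impI)
    fix e :: real assume "e > 0"
    then obtain U where "V \<subseteq> U" "U \<subseteq> W" "sofic A U" "\<bar>shift_entropy U - h\<bar> < e"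
      using sofic_entropies_dense[OF assms(1-6) h] by blast
    then show "\<exists>y\<in>{shift_entropy U |U. V \<subseteq> U \<and> U \<subseteq> W \<and> sofic A U}. dist y h < e"
      by (auto simp: dist_real_def)
  qed
qed

end
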